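(* Let $k$ be a differential field of characteristic $0$ with commuting derivations $\delta_1,\ldots,\delta_m$, and let $A=k\{x,y\}$ be the algebra of differential polynomials over $k$ in two variables. Then the group $T(A)$ of tame automorphisms of $A$ is the free product of the subgroup $Af_2(A)$ of affine automorphisms and the subgroup $Tr_2(A)$ of triangular automorphisms with amalgamated subgroup $C=Af_2(A)\cap Tr_2(A)$, i.e. $$T(A)=Af_2(A)\ast_{C}Tr_2(A).$$
   Context: Let $\Delta=\{\delta_1,\ldots,\delta_m\}$ be a finite set of symbols for derivations ($m\ge 0$), and let $\Theta$ be the free commutative monoid on $\Delta$. A differential ring ($\Delta$-ring) is a commutative ring with unit on which $\delta_1,\ldots,\delta_m$ act as pairwise commuting derivations; a differential field is a field that is a differential ring. For a differential field $k$, $k\{x,y\}$ denotes the polynomial algebra $k[x^\theta,y^\theta \mid \theta\in\Theta]$ in the algebraically independent variables $x^\theta,y^\theta$, with $x=x^1$, $y=y^1$, made into a differential algebra by the given action of $\delta_i$ on $k$ and $\delta_i(x^\theta)=x^{\theta\delta_i}$, $\delta_i(y^\theta)=y^{\theta\delta_i}$. For an element $u$, write $u^{\theta}=\theta(u)$. $k\{y\}$ and $k\{x\}$ are the analogous one-variable algebras. $Aut(A)$ is the group of automorphisms of $A$ as a differential $k$-algebra ($k$-algebra automorphisms commuting with all $\delta_i$). An automorphism $\varphi$ is written $\varphi=(f_1,f_2)$ where $\varphi(x)=f_1$, $\varphi(y)=f_2$. The product is $(f_1,f_2)\circ(g_1,g_2)=(g_1(f_1,f_2),g_2(f_1,f_2))$.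 Elementary automorphisms are those of the form $(ax+f(y),y)$ or $(x,ay+g(x))$ with $0\ne a\in k$, $f(y)\in k\{y\}$, $g(x)\in k\{x\}$. $T(A)$ is the subgroup of $Aut(A)$ generated by all elementary automorphisms; its elements are called tame. $Af_2(A)$ is the group of automorphisms $(a_1x+b_1y+c_1,\,a_2x+b_2y+c_2)$ with $a_i,b_i,c_i\in k$, $a_1b_2\ne a_2b_1$. $Tr_2(A)$ is the group of automorphisms $(ax+f(y),\,by+c)$ with $0\ne a,b\in k$, $c\in k$, $f(y)\in k\{y\}$. A group $G$ with subgroups $G_1,G_2$ and $G_0=G_1\cap G_2$ is the free product of $G_1$ and $G_2$ with amalgamated subgroup $G_0$, written $G=G_1\ast_{G_0}G_2$, if $G$ is generated by $G_1$ and $G_2$ and the defining relations of $G$ consist only of the defining relations of $G_1$ and $G_2$ (i.e. the natural homomorphism from the amalgamated free product of $G_1$ and $G_2$ over $G_0$ to $G$ is an isomorphism). *)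

theory Defs
  imports Main "HOL-Library.Poly_Mapping" "HOL-Algebra.Bij" "HOL-Algebra.Generated_Groups"
begin

section \<open>Differential rings\<close>

text \<open>
  The derivation symbols are the elements of a set \<open>\<Delta>\<close>, which may be empty; the derivation
  attached to \<open>d \<in> \<Delta>\<close> is \<open>D d\<close>. Values of \<open>D\<close> outside \<open>\<Delta>\<close> are irrelevant.
\<close>

definition differential_ring :: "'d set \<Rightarrow> ('d \<Rightarrow> 'k::comm_ring_1 \<Rightarrow> 'k) \<Rightarrow> bool" where
  "differential_ring \<Delta> D \<longleftrightarrow>
     (\<forall>d\<in>\<Delta>. \<forall>a b. D d (a + b) = D d a + D d b) \<and>
     (\<forall>d\<in>\<Delta>. \<forall>a b. D d (a * b) = D d a * b + a * D d b) \<and>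
     (\<forall>d\<in>\<Delta>. \<forall>e\<in>\<Delta>. \<forall>a. D d (D e a) = D e (D d a))"

section \<open>Differential polynomials in two variables\<close>

datatype gen = GX | GY

text \<open>
  The free commutative monoid on the derivation symbols is written additively, as
  \<open>'d \<Rightarrow>\<^sub>0 nat\<close>; the pair \<open>(z, \<theta>)\<close> is the variable $z^\theta$.
\<close>

type_synonym 'd dvar = "gen \<times> ('d \<Rightarrow>\<^sub>0 nat)"
type_synonym ('d, 'k) dpoly = "('d dvar \<Rightarrow>\<^sub>0 nat) \<Rightarrow>\<^sub>0 'k"

definition Const :: "'k::zero \<Rightarrow> ('d, 'k) dpoly" where
  "Const c = Poly_Mapping.single 0 c"

definition Var :: "'d dvar \<Rightarrow> ('d, 'k::zero_neq_one) dpoly" where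
  "Var v = Poly_Mapping.single (Poly_Mapping.single v 1) 1"

definition vx :: "('d, 'k::zero_neq_one) dpoly" where "vx = Var (GX, 0)"
definition vy :: "('d, 'k::zero_neq_one) dpoly" where "vy = Var (GY, 0)"

definition vars :: "('d, 'k::zero) dpoly \<Rightarrow> 'd dvar set" where
  "vars p = (\<Union>m\<in>Poly_Mapping.keys p. Poly_Mapping.keys m)"

definition Theta :: "'d set \<Rightarrow> ('d \<Rightarrow>\<^sub>0 nat) set" where
  "Theta \<Delta> = {\<theta>. Poly_Mapping.keys \<theta> \<subseteq> \<Delta>}"

definition dpolys :: "'d set \<Rightarrow> ('d, 'k::zero) dpoly set" where
  "dpolys \<Delta> = {p. vars p \<subseteq> UNIV \<times> Theta \<Delta>}"

definition dpolys1 :: "'d set \<Rightarrow> gen \<Rightarrow> ('d, 'k::zero) dpoly set" where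
  "dpolys1 \<Delta> z = {p. vars p \<subseteq> {z} \<times> Theta \<Delta>}"

definition dshift :: "'d \<Rightarrow> 'd dvar \<Rightarrow> 'd dvar" where
  "dshift d v = (fst v, snd v + Poly_Mapping.single d 1)"

text \<open>
  The extension of \<open>D d\<close> to differential polynomials, obtained by applying the Leibniz rule
  to each term $c \prod_v v^{m(v)}$.
\<close>

definition dterm ::
    "('d \<Rightarrow> 'k::comm_ring_1 \<Rightarrow> 'k) \<Rightarrow> 'd \<Rightarrow> ('d dvar \<Rightarrow>\<^sub>0 nat) \<Rightarrow> 'k \<Rightarrow> ('d, 'k) dpoly" where
  "dterm D d m c =
     Poly_Mapping.single m (D d c) +
     (\<Sum>v\<in>Poly_Mapping.keys m.
        Poly_Mapping.single
          (m - Poly_Mapping.single v 1 + Poly_Mapping.single (dshift d v) 1)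
          (of_nat (Poly_Mapping.lookup m v) * c))"

definition dderiv ::
    "('d \<Rightarrow> 'k::comm_ring_1 \<Rightarrow> 'k) \<Rightarrow> 'd \<Rightarrow> ('d, 'k) dpoly \<Rightarrow> ('d, 'k) dpoly" where
  "dderiv D d p = (\<Sum>m\<in>Poly_Mapping.keys p. dterm D d m (Poly_Mapping.lookup p m))"

text \<open>
  The following facts say that the maps \<open>dderiv D d\<close> are pairwise commuting derivations of
  \<open>dpolys \<Delta>\<close> that extend \<open>D d\<close> and map $z^\theta$ to $z^{\theta\delta}$, \<open>\<delta>\<close> being
  the symbol \<open>d\<close>.
\<close>

lemma dderiv_single:
  assumes "D d 0 = 0"
  shows "dderiv D d (Poly_Mapping.single m c) = dterm D d m c"
  using assms by (simp add: dderiv_def dterm_def)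

lemma dderiv_Const:
  assumes "D d 0 = 0"
  shows "dderiv D d (Const c) = Const (D d c)"
  using assms by (simp add: Const_def dderiv_single) (simp add: dterm_def)

lemma dderiv_Var:
  assumes "D d 0 = 0" "D d 1 = 0"
  shows "dderiv D d (Var v) = Var (dshift d v)"
  using assms by (simp add: Var_def dderiv_single) (simp add: dterm_def)

lemma dterm_zero: "D d 0 = 0 \<Longrightarrow> dterm D d m 0 = 0"
  by (simp add: dterm_def)

lemma dterm_add:
  assumes "\<And>a b. D d (a + b) = D d a + D d b"
  shows "dterm D d m (a + b) = dterm D d m a + dterm D d m b"
  by (simp add: dterm_def assms single_add distrib_left sum.distrib algebra_simps)

lemma dderiv_superset:
  assumes "D d 0 = 0" "finite S" "Poly_Mapping.keys p \<subseteq> S"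
  shows "dderiv D d p = (\<Sum>m\<in>S. dterm D d m (Poly_Mapping.lookup p m))"
  unfolding dderiv_def using assms
  by (intro sum.mono_neutral_left) (auto simp: in_keys_iff dterm_zero)

lemma dderiv_add:
  assumes add: "\<And>a b. D d (a + b) = D d a + D d b"
  shows "dderiv D d (p + q) = dderiv D d p + dderiv D d q"
proof -
  let ?S = "Poly_Mapping.keys p \<union> Poly_Mapping.keys q"
  have 0: "D d 0 = 0" using add[of 0 0] by simp
  have "dderiv D d (p + q) = (\<Sum>m\<in>?S. dterm D d m (Poly_Mapping.lookup (p + q) m))"
    by (rule dderiv_superset) (use 0 Poly_Mapping.keys_add[of p q] in auto)
  also have "\<dots> = (\<Sum>m\<in>?S. dterm D d m (Poly_Mapping.lookup p m)) +
                   (\<Sum>m\<in>?S. dterm D d m (Poly_Mapping.lookup q m))"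
    by (simp add: lookup_add dterm_add[where D = D and d = d, OF add] sum.distrib)
  also have "\<dots> = dderiv D d p + dderiv D d q"
    using 0 by (simp add: dderiv_superset[of D d ?S])
  finally show ?thesis .
qed

lemma dpoly_eq_sum_single:
  fixes p :: "('d, 'k::comm_ring_1) dpoly"
  shows "p = (\<Sum>m\<in>Poly_Mapping.keys p. Poly_Mapping.single m (Poly_Mapping.lookup p m))"
  by (rule poly_mapping_eqI)
     (auto simp: lookup_sum lookup_single when_def in_keys_iff)

lemma dterm_superset:
  assumes "finite S" "Poly_Mapping.keys m \<subseteq> S"
  shows "dterm D d m c = Poly_Mapping.single m (D d c) +
     (\<Sum>v\<in>S. Poly_Mapping.single
          (m - Poly_Mapping.single v 1 + Poly_Mapping.single (dshift d v) 1)
          (of_nat (Poly_Mapping.lookup m v) * c))"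
  unfolding dterm_def using assms
  by (intro arg_cong2[where f = "(+)"] sum.mono_neutral_left refl) (auto simp: in_keys_iff)

lemma monom_minus_add:
  fixes m n s :: "'v \<Rightarrow>\<^sub>0 nat"
  assumes "Poly_Mapping.lookup m v \<noteq> 0"
  shows "m + n - Poly_Mapping.single v 1 + s = m - Poly_Mapping.single v 1 + s + n"
  by (rule poly_mapping_eqI)
     (use assms in \<open>auto simp: lookup_add lookup_minus lookup_single when_def\<close>)

lemma dterm_mult:
  fixes D :: "'d \<Rightarrow> 'k::comm_ring_1 \<Rightarrow> 'k"
  assumes mult: "\<And>a b. D d (a * b) = D d a * b + a * D d b"
  shows "dterm D d (m + n) (a * b) =
           dterm D d m a * Poly_Mapping.single n b + Poly_Mapping.single m a * dterm D d n b"
proof -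
  let ?S = "Poly_Mapping.keys m \<union> Poly_Mapping.keys n"
  let ?t = "\<lambda>m c v. Poly_Mapping.single
          (m - Poly_Mapping.single v 1 + Poly_Mapping.single (dshift d v) 1)
          (of_nat (Poly_Mapping.lookup m v) * c) :: ('d, 'k) dpoly"
  have t: "?t (m + n) (a * b) v =
      ?t m a v * Poly_Mapping.single n b + Poly_Mapping.single m a * ?t n b v" for v
  proof -
    have 1: "Poly_Mapping.single (m + n - Poly_Mapping.single v 1 + s)
               (of_nat (Poly_Mapping.lookup m v) * (a * b)) =
             Poly_Mapping.single (m - Poly_Mapping.single v 1 + s)
               (of_nat (Poly_Mapping.lookup m v) * a) * Poly_Mapping.single n b" for s
      by (cases "Poly_Mapping.lookup m v = 0")
         (simp_all only: monom_minus_add mult_single of_nat_0 mult_zero_left single_zero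
            mult.assoc not_False_eq_True)
    have 2: "Poly_Mapping.single (m + n - Poly_Mapping.single v 1 + s)
               (of_nat (Poly_Mapping.lookup n v) * (a * b)) =
             Poly_Mapping.single m a * Poly_Mapping.single (n - Poly_Mapping.single v 1 + s)
               (of_nat (Poly_Mapping.lookup n v) * b)" for s
      using monom_minus_add[of n v m s]
      by (cases "Poly_Mapping.lookup n v = 0")
         (simp_all only: mult_single of_nat_0 mult_zero_left mult_zero_right single_zero
            add.commute[of m n] add.commute[of m "_ + s"] mult.left_commute not_False_eq_True)
    show ?thesis
      by (simp only: lookup_add of_nat_add distrib_right single_add 1 2)
  qed
  have "dterm D d (m + n) (a * b) =
      Poly_Mapping.single (m + n) (D d (a * b)) + (\<Sum>v\<in>?S. ?t (m + n) (a * b) v)"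
    by (rule dterm_superset) (use Poly_Mapping.keys_add[of m n] in auto)
  also have "\<dots> = Poly_Mapping.single (m + n) (D d (a * b)) +
      ((\<Sum>v\<in>?S. ?t m a v) * Poly_Mapping.single n b +
       Poly_Mapping.single m a * (\<Sum>v\<in>?S. ?t n b v))"
    by (simp only: t sum.distrib sum_distrib_left sum_distrib_right)
  also have "\<dots> = (Poly_Mapping.single m (D d a) + (\<Sum>v\<in>?S. ?t m a v)) * Poly_Mapping.single n b +
      Poly_Mapping.single m a * (Poly_Mapping.single n (D d b) + (\<Sum>v\<in>?S. ?t n b v))"
    by (simp add: mult single_add mult_single distrib_left distrib_right)
  also have "\<dots> = dterm D d m a * Poly_Mapping.single n b + Poly_Mapping.single m a * dterm D d n b"
    by (simp add: dterm_superset[of ?S])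
  finally show ?thesis .
qed

lemma dderiv_sum:
  assumes "\<And>a b. D d (a + b) = D d a + D d b"
  shows "dderiv D d (\<Sum>i\<in>I. f i) = (\<Sum>i\<in>I. dderiv D d (f i))"
  by (induction I rule: infinite_finite_induct)
     (simp_all add: dderiv_add[where D = D and d = d, OF assms], simp_all add: dderiv_def)

lemma dderiv_mult:
  fixes D :: "'d \<Rightarrow> 'k::comm_ring_1 \<Rightarrow> 'k"
  assumes add: "\<And>a b. D d (a + b) = D d a + D d b"
    and mult: "\<And>a b. D d (a * b) = D d a * b + a * D d b"
  shows "dderiv D d (p * q) = dderiv D d p * q + p * dderiv D d q"
proof -
  have 0: "D d 0 = 0" using add[of 0 0] by simp
  let ?s = "\<lambda>p m. Poly_Mapping.single m (Poly_Mapping.lookup p m) :: ('d, 'k) dpoly"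
  let ?P = "Poly_Mapping.keys p" and ?Q = "Poly_Mapping.keys q"
  have s: "dderiv D d (?s p m * ?s q n) = dderiv D d (?s p m) * ?s q n + ?s p m * dderiv D d (?s q n)"
    for m n
    by (simp add: mult_single dderiv_single[where D = D and d = d, OF 0] dterm_mult[where D = D and d = d, OF mult])
  have "dderiv D d ((\<Sum>m\<in>?P. ?s p m) * (\<Sum>n\<in>?Q. ?s q n)) =
      dderiv D d (\<Sum>m\<in>?P. ?s p m) * (\<Sum>n\<in>?Q. ?s q n) +
      (\<Sum>m\<in>?P. ?s p m) * dderiv D d (\<Sum>n\<in>?Q. ?s q n)"
    by (simp add: sum_product dderiv_sum[where D = D and d = d, OF add] s sum.distrib)
  then show ?thesis
    by (simp only: dpoly_eq_sum_single[symmetric])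
qed

lemma vars_sum: "vars (\<Sum>i\<in>I. f i) \<subseteq> (\<Union>i\<in>I. vars (f i))"
  unfolding vars_def using Poly_Mapping.keys_sum[of f I] by fastforce

lemma dderiv_closed:
  assumes "d \<in> \<Delta>" "p \<in> dpolys \<Delta>"
  shows "dderiv D d p \<in> dpolys \<Delta>"
proof -
  have *: "vars (Poly_Mapping.single m c) \<subseteq> Poly_Mapping.keys m" for m :: "'a dvar \<Rightarrow>\<^sub>0 nat" and c :: 'b
    by (auto simp: vars_def)
  have "vars (dterm D d m c) \<subseteq> UNIV \<times> Theta \<Delta>"
    if m: "Poly_Mapping.keys m \<subseteq> UNIV \<times> Theta \<Delta>" for m c
  proof -
    have "Poly_Mapping.keys (m - Poly_Mapping.single v 1 + Poly_Mapping.single (dshift d v) 1)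
            \<subseteq> UNIV \<times> Theta \<Delta>" if v: "v \<in> Poly_Mapping.keys m" for v
    proof -
      have "Poly_Mapping.keys (m - Poly_Mapping.single v 1) \<subseteq> Poly_Mapping.keys m"
        by (auto simp: in_keys_iff lookup_minus)
      moreover have "dshift d v \<in> UNIV \<times> Theta \<Delta>"
        using subsetD[OF m v] assms(1) Poly_Mapping.keys_add[of "snd v" "Poly_Mapping.single d 1"]
        by (cases v) (auto simp: dshift_def Theta_def)
      ultimately show ?thesis
        using m by (intro order.trans[OF Poly_Mapping.keys_add] Un_least) auto
    qed
    then have "vars (\<Sum>v\<in>Poly_Mapping.keys m. Poly_Mapping.single
        (m - Poly_Mapping.single v 1 + Poly_Mapping.single (dshift d v) 1)
        (of_nat (Poly_Mapping.lookup m v) * c)) \<subseteq> UNIV \<times> Theta \<Delta>"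
      by (intro order.trans[OF vars_sum] UN_least order.trans[OF *])
    moreover have "vars (Poly_Mapping.single m (D d c)) \<subseteq> UNIV \<times> Theta \<Delta>"
      by (rule order.trans[OF * m])
    moreover have "vars (p + q) \<subseteq> vars p \<union> vars q" for p q :: "('a, 'b) dpoly"
      using Poly_Mapping.keys_add[of p q] by (auto simp: vars_def)
    ultimately show ?thesis
      unfolding dterm_def by blast
  qed
  moreover have "Poly_Mapping.keys m \<subseteq> UNIV \<times> Theta \<Delta>" if "m \<in> Poly_Mapping.keys p" for m
    using assms(2) that by (auto simp: dpolys_def vars_def)
  ultimately show ?thesis
    unfolding dpolys_def dderiv_def mem_Collect_eq
    by (intro order.trans[OF vars_sum] UN_least) auto
qed

lemma dpoly_induct:
  fixes p :: "('d, 'k::comm_ring_1) dpoly"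
  assumes C: "\<And>c. P (Const c)" and V: "\<And>v. P (Var v)"
    and A: "\<And>p q. P p \<Longrightarrow> P q \<Longrightarrow> P (p + q)" and M: "\<And>p q. P p \<Longrightarrow> P q \<Longrightarrow> P (p * q)"
  shows "P p"
proof -
  have pow: "P (Poly_Mapping.single (Poly_Mapping.single v n) 1)" for v n
  proof (induction n)
    case 0 show ?case using C[of 1] by (simp add: Const_def)
  next
    case (Suc n)
    have "Poly_Mapping.single (Poly_Mapping.single v (Suc n)) 1 =
        Var v * (Poly_Mapping.single (Poly_Mapping.single v n) 1 :: ('d, 'k) dpoly)"
      by (simp add: Var_def mult_single single_add[symmetric])
    then show ?case using M[OF V Suc] by simp
  qed
  have sums: "P (Poly_Mapping.single (\<Sum>v\<in>S. Poly_Mapping.single v (f v)) 1)" if "finite S" for S f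
    using that
  proof (induction S)
    case empty show ?case using C[of 1] by (simp add: Const_def)
  next
    case (insert v S)
    have "Poly_Mapping.single (\<Sum>v\<in>insert v S. Poly_Mapping.single v (f v)) 1 =
        Poly_Mapping.single (Poly_Mapping.single v (f v)) 1 *
        (Poly_Mapping.single (\<Sum>v\<in>S. Poly_Mapping.single v (f v)) 1 :: ('d, 'k) dpoly)"
      using insert by (simp add: mult_single)
    then show ?case using M[OF pow insert.IH] by simp
  qed
  have mon: "P (Poly_Mapping.single m c)" for m c
  proof -
    have "m = (\<Sum>v\<in>Poly_Mapping.keys m. Poly_Mapping.single v (Poly_Mapping.lookup m v))"
      by (rule poly_mapping_eqI) (auto simp: lookup_sum lookup_single when_def in_keys_iff)
    then have "P (Poly_Mapping.single m 1)"
      using sums[of "Poly_Mapping.keys m" "Poly_Mapping.lookup m"] by simp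
    from M[OF C[of c] this] show ?thesis by (simp add: Const_def mult_single)
  qed
  have "P (\<Sum>m\<in>S. Poly_Mapping.single m (Poly_Mapping.lookup p m))" if "finite S" for S
    using that
  proof (induction S)
    case empty show ?case using C[of 0] by (simp add: Const_def)
  next
    case (insert m S) then show ?case using A[OF mon insert.IH] by simp
  qed
  from this[of "Poly_Mapping.keys p"] show ?thesis
    by (simp only: dpoly_eq_sum_single[symmetric] finite_keys)
qed

lemma dderiv_commute:
  fixes D :: "'d \<Rightarrow> 'k::comm_ring_1 \<Rightarrow> 'k"
  assumes D: "differential_ring \<Delta> D" and d: "d \<in> \<Delta>" and e: "e \<in> \<Delta>"
  shows "dderiv D d (dderiv D e p) = dderiv D e (dderiv D d p)"
proof -
  have add: "D i (a + b) = D i a + D i b" and mult: "D i (a * b) = D i a * b + a * D i b"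
    if "i \<in> \<Delta>" for i a b
    using D that by (auto simp: differential_ring_def)
  have 0: "D i 0 = 0" and 1: "D i 1 = 0" if "i \<in> \<Delta>" for i
    using add[OF that, of 0 0] mult[OF that, of 1 1] by simp_all
  note A = dderiv_add[where D = D, OF add] and M = dderiv_mult[where D = D, OF add mult]
  show ?thesis
  proof (induction p rule: dpoly_induct)
    case (1 c)
    then show ?case
      using D d e by (simp add: dderiv_Const 0 differential_ring_def)
  next
    case (2 v)
    then show ?case
      using d e by (simp add: dderiv_Var 0 1 dshift_def ac_simps)
  next
    case (3 p q)
    then show ?case by (simp add: A[OF d] A[OF e])
  next
    case (4 p q)
    then show ?case by (simp add: A[OF d] A[OF e] M[OF d d] M[OF e e] algebra_simps)
  qed
qed

section \<open>Automorphisms\<close>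

definition auts :: "'d set \<Rightarrow> ('d \<Rightarrow> 'k::comm_ring_1 \<Rightarrow> 'k) \<Rightarrow> (('d, 'k) dpoly \<Rightarrow> ('d, 'k) dpoly) set"
  where
  "auts \<Delta> D = {\<phi> \<in> Bij (dpolys \<Delta>).
     (\<forall>p\<in>dpolys \<Delta>. \<forall>q\<in>dpolys \<Delta>. \<phi> (p + q) = \<phi> p + \<phi> q \<and> \<phi> (p * q) = \<phi> p * \<phi> q) \<and>
     (\<forall>c. \<phi> (Const c) = Const c) \<and>
     (\<forall>d\<in>\<Delta>. \<forall>p\<in>dpolys \<Delta>. \<phi> (dderiv D d p) = dderiv D d (\<phi> p))}"

text \<open>
  The product of \<open>BijGroup\<close> is composition of maps (right factor applied first), which is
  $(f_1,f_2)\circ(g_1,g_2) = (g_1(f_1,f_2), g_2(f_1,f_2))$ on the images of \<open>vx\<close> and \<open>vy\<close>.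
\<close>

definition Aut ::
    "'d set \<Rightarrow> ('d \<Rightarrow> 'k::comm_ring_1 \<Rightarrow> 'k) \<Rightarrow> (('d, 'k) dpoly \<Rightarrow> ('d, 'k) dpoly) monoid" where
  "Aut \<Delta> D = (BijGroup (dpolys \<Delta>)) \<lparr>carrier := auts \<Delta> D\<rparr>"

definition elementary ::
    "'d set \<Rightarrow> ('d \<Rightarrow> 'k::field \<Rightarrow> 'k) \<Rightarrow> (('d, 'k) dpoly \<Rightarrow> ('d, 'k) dpoly) set" where
  "elementary \<Delta> D =
     {\<phi> \<in> auts \<Delta> D. \<exists>a f. a \<noteq> 0 \<and> f \<in> dpolys1 \<Delta> GY \<and> \<phi> vx = Const a * vx + f \<and> \<phi> vy = vy} \<union>
     {\<phi> \<in> auts \<Delta> D. \<exists>a g. a \<noteq> 0 \<and> g \<in> dpolys1 \<Delta> GX \<and> \<phi> vx = vx \<and> \<phi> vy = Const a * vy + g}"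

definition Tame ::
    "'d set \<Rightarrow> ('d \<Rightarrow> 'k::field \<Rightarrow> 'k) \<Rightarrow> (('d, 'k) dpoly \<Rightarrow> ('d, 'k) dpoly) monoid" where
  "Tame \<Delta> D = (Aut \<Delta> D) \<lparr>carrier := generate (Aut \<Delta> D) (elementary \<Delta> D)\<rparr>"

definition Af2 ::
    "'d set \<Rightarrow> ('d \<Rightarrow> 'k::field \<Rightarrow> 'k) \<Rightarrow> (('d, 'k) dpoly \<Rightarrow> ('d, 'k) dpoly) set" where
  "Af2 \<Delta> D = {\<phi> \<in> auts \<Delta> D. \<exists>a1 b1 c1 a2 b2 c2. a1 * b2 \<noteq> a2 * b1 \<and>
     \<phi> vx = Const a1 * vx + Const b1 * vy + Const c1 \<and>
     \<phi> vy = Const a2 * vx + Const b2 * vy + Const c2}"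

definition Tr2 ::
    "'d set \<Rightarrow> ('d \<Rightarrow> 'k::field \<Rightarrow> 'k) \<Rightarrow> (('d, 'k) dpoly \<Rightarrow> ('d, 'k) dpoly) set" where
  "Tr2 \<Delta> D = {\<phi> \<in> auts \<Delta> D. \<exists>a b c f. a \<noteq> 0 \<and> b \<noteq> 0 \<and> f \<in> dpolys1 \<Delta> GY \<and>
     \<phi> vx = Const a * vx + f \<and> \<phi> vy = Const b * vy + Const c}"

section \<open>Amalgamated free products\<close>

text \<open>
  The free product of \<open>H\<close> and \<open>K\<close> with a common subgroup \<open>C\<close> amalgamated is given by its standard
  presentation: words in the disjoint union of \<open>H\<close> and \<open>K\<close>, modulo the congruence generated by
  the multiplication tables of \<open>H\<close> and \<open>K\<close> and the identification of the two copies of \<open>C\<close>.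
\<close>

definition amalg_words :: "('a, 'm) monoid_scheme \<Rightarrow> ('a, 'n) monoid_scheme \<Rightarrow> ('a + 'a) list set" where
  "amalg_words H K = lists (carrier H <+> carrier K)"

inductive_set amalg_rel ::
    "('a, 'm) monoid_scheme \<Rightarrow> ('a, 'n) monoid_scheme \<Rightarrow> 'a set \<Rightarrow> (('a + 'a) list \<times> ('a + 'a) list) set"
  for H :: "('a, 'm) monoid_scheme" and K :: "('a, 'n) monoid_scheme" and C :: "'a set" where
  refl: "w \<in> amalg_words H K \<Longrightarrow> (w, w) \<in> amalg_rel H K C"
| sym: "(u, v) \<in> amalg_rel H K C \<Longrightarrow> (v, u) \<in> amalg_rel H K C"
| trans: "(u, v) \<in> amalg_rel H K C \<Longrightarrow> (v, w) \<in> amalg_rel H K C \<Longrightarrow> (u, w) \<in> amalg_rel H K C"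
| append: "(u, u') \<in> amalg_rel H K C \<Longrightarrow> (v, v') \<in> amalg_rel H K C \<Longrightarrow>
    (u @ v, u' @ v') \<in> amalg_rel H K C"
| one_left: "([Inl \<one>\<^bsub>H\<^esub>], []) \<in> amalg_rel H K C"
| one_right: "([Inr \<one>\<^bsub>K\<^esub>], []) \<in> amalg_rel H K C"
| mult_left: "a \<in> carrier H \<Longrightarrow> b \<in> carrier H \<Longrightarrow>
    ([Inl a, Inl b], [Inl (a \<otimes>\<^bsub>H\<^esub> b)]) \<in> amalg_rel H K C"
| mult_right: "a \<in> carrier K \<Longrightarrow> b \<in> carrier K \<Longrightarrow>
    ([Inr a, Inr b], [Inr (a \<otimes>\<^bsub>K\<^esub> b)]) \<in> amalg_rel H K C"
| amalg: "c \<in> C \<Longrightarrow> ([Inl c], [Inr c]) \<in> amalg_rel H K C"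

definition amalg_product ::
    "('a, 'm) monoid_scheme \<Rightarrow> ('a, 'n) monoid_scheme \<Rightarrow> 'a set \<Rightarrow> ('a + 'a) list set monoid" where
  "amalg_product H K C =
     \<lparr>carrier = amalg_words H K // amalg_rel H K C,
      mult = \<lambda>P Q. \<Union>u\<in>P. \<Union>v\<in>Q. amalg_rel H K C `` {u @ v},
      one = amalg_rel H K C `` {[]}\<rparr>"

definition word_eval :: "('a, 'm) monoid_scheme \<Rightarrow> ('a + 'a) list \<Rightarrow> 'a" where
  "word_eval G w = foldr (\<lambda>l g. case_sum id id l \<otimes>\<^bsub>G\<^esub> g) w \<one>\<^bsub>G\<^esub>"

text \<open>
  All words in a class have the same value in \<open>G\<close>, so the natural homomorphism maps a class to the
  unique element of its image under \<open>word_eval\<close>.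
\<close>

definition amalg_natural :: "('a, 'm) monoid_scheme \<Rightarrow> ('a + 'a) list set \<Rightarrow> 'a" where
  "amalg_natural G P = the_elem (word_eval G ` P)"

definition is_amalgamated_free_product ::
    "('a, 'm) monoid_scheme \<Rightarrow> 'a set \<Rightarrow> 'a set \<Rightarrow> 'a set \<Rightarrow> bool" where
  "is_amalgamated_free_product G G1 G2 G0 \<longleftrightarrow>
     group G \<and> subgroup G1 G \<and> subgroup G2 G \<and> G0 = G1 \<inter> G2 \<and>
     amalg_natural G \<in> iso (amalg_product (G\<lparr>carrier := G1\<rparr>) (G\<lparr>carrier := G2\<rparr>) G0) G"

end

theory Submission
  imports Defs "HOL-Library.Multiset_Order" "HOL-Computational_Algebra.Primes"
begin

text \<open>
  A group generated by two subgroups is their free product with the intersection amalgamated as soon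
  as no nonempty word that alternates between the two subgroups, with all letters outside the
  intersection, has value one (\<open>amalgam_criterion\<close>). Multiply such a word of automorphisms out
  from the left and watch the pair \<open>(f\<^sub>1, f\<^sub>2)\<close> of images of \<open>x\<close> and \<open>y\<close>. A triangular letter
  that is not affine turns it into \<open>(a f\<^sub>1 + f(f\<^sub>2), b f\<^sub>2 + c)\<close>, where \<open>f\<close> is not of the form
  \<open>b y + c\<close>; an affine letter that is not triangular turns it into two combinations of \<open>f\<^sub>1\<close>, \<open>f\<^sub>2\<close>
  and \<open>1\<close>, the second of which involves \<open>f\<^sub>1\<close>. If there is a notion of size for which \<open>f(f\<^sub>2)\<close> is always
  larger than \<open>f\<^sub>2\<close>, then \<open>f\<^sub>1\<close> is the larger one after each triangular letter, \<open>f\<^sub>2\<close> is at least as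
  large as \<open>f\<^sub>1\<close> after each affine letter, and the larger of the two grows with each triangular letter
  (\<open>triangular_step\<close>, \<open>affine_step\<close>), so that the identity is never reached.
  
  For ordinary polynomials the degree is such a size. For differential polynomials it is not, because
  the substitution of \<open>g\<close> into \<open>y\<^sup>\<theta>\<close> does not raise the degree, and because one has to know that the
  terms of \<open>f(g)\<close> do not cancel, that is, that the derivatives of \<open>g\<close> are algebraically
  independent. Both points are settled by leading monomials. Rank the variables so that derivations
  increase the rank and preserve strict inequalities of ranks, and order monomials lexicographically,
  the variable of highest rank first. If \<open>u\<close> is the variable of highest rank in the leading monomial \<open>m\<close> of \<open>g\<close>, then
  \<open>(m/u) u\<^sup>\<theta>\<close> is the leading monomial of \<open>\<theta>(g)\<close> (\<open>lead_dderiv\<close>, \<open>lead_dhom_Var\<close>): the first derivation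
  multiplies the leading coefficient by the exponent of \<open>u\<close> in \<open>m\<close>, which is not zero in
  characteristic zero. Distinct products of the monomials \<open>(m/u) u\<^sup>\<theta>\<close> are distinct monomials
  (\<open>shifted_multisets_inj\<close>), so the leading terms of the terms of \<open>f(g)\<close> cannot cancel, and one of them
  lies above \<open>m\<close> unless \<open>f = b y + c\<close> (\<open>LT_dhom_nonlinear\<close>).
  
  It remains that tame automorphisms are generated by affine and triangular ones. The map that
  exchanges \<open>x\<close> and \<open>y\<close> conjugates \<open>(x, a y + g(x))\<close> to a triangular automorphism, and Gaussian
  elimination writes an affine automorphism as a product of elementary ones. The affine
  automorphisms needed for this exist by the universal property of \<open>k{x,y}\<close> (\<open>dhom_exists\<close>).
\<close>

section \<open>A criterion for amalgamated free products\<close>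

definition alternating :: "'a set \<Rightarrow> ('a + 'a) list \<Rightarrow> bool" where
  "alternating C w \<longleftrightarrow>
     (\<forall>l\<in>set w. case_sum id id l \<notin> C) \<and> successively (\<lambda>l l'. isl l \<noteq> isl l') w"

text \<open>
  If a word of length at least two fails to alternate, the failure is visible in two neighbouring
  letters, and those can be multiplied. (A single letter has no neighbour, whence the bound.)
\<close>

lemma alternatingI:
  assumes "length w \<ge> 2"
    and "\<And>u l l' v. w = u @ [l, l'] @ v \<Longrightarrow>
           isl l \<noteq> isl l' \<and> case_sum id id l \<notin> C \<and> case_sum id id l' \<notin> C"
  shows "alternating C w"
  using assms
proof (induction w)
  case (Cons a w)
  from Cons.prems(1) obtain b w' where w: "w = b # w'" by (cases w) auto
  have ab: "isl a \<noteq> isl b" "case_sum id id a \<notin> C" "case_sum id id b \<notin> C"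
    using Cons.prems(2)[of "[]" a b w'] w by auto
  show ?case
  proof (cases "w' = []")
    case True
    with ab w show ?thesis by (auto simp: alternating_def)
  next
    case False
    have "alternating C w"
    proof (rule Cons.IH)
      show "length w \<ge> 2" using False w by (cases w') auto
      show "isl l \<noteq> isl l' \<and> case_sum id id l \<notin> C \<and> case_sum id id l' \<notin> C"
        if "w = u @ [l, l'] @ v" for u l l' v
        using Cons.prems(2)[of "a # u" l l' v] that by simp
    qed
    with ab w show ?thesis by (auto simp: alternating_def)
  qed
qed simp

lemma alternating_Cons:
  "alternating C (l # w) \<longleftrightarrow>
     case_sum id id l \<notin> C \<and> (w = [] \<or> isl l \<noteq> isl (hd w)) \<and> alternating C w"
  by (cases w) (auto simp: alternating_def)

lemma (in group) word_eval_closed: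
  assumes "w \<in> lists (H <+> K)" "H \<subseteq> carrier G" "K \<subseteq> carrier G"
  shows "word_eval G w \<in> carrier G"
  using assms by (induction w) (auto simp: word_eval_def)

text \<open>
  A word that does not alternate contains two neighbouring letters that the defining relations
  merge into one: both come from the same subgroup, or one of them lies in both. So a word of value
  one can be shortened until at most one letter is left, and that letter is then the identity.
  Every word of value one is therefore equivalent to the empty word, which is the injectivity of the
  natural homomorphism.
\<close>

lemma amalgam_criterion:
  fixes G (structure)
  assumes "group G" and H: "subgroup H G" and K: "subgroup K G"
    and gen: "carrier G \<subseteq> generate G (H \<union> K)"
    and alt: "\<And>w. w \<in> lists (H <+> K) \<Longrightarrow> w \<noteq> [] \<Longrightarrow> alternating (H \<inter> K) w \<Longrightarrow>
                word_eval G w \<noteq> \<one>"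
  shows "is_amalgamated_free_product G H K (H \<inter> K)"
proof -
  interpret group G by fact
  define R where "R = amalg_rel (G\<lparr>carrier := H\<rparr>) (G\<lparr>carrier := K\<rparr>) (H \<inter> K)"
  define W where "W = lists (H <+> K)"
  have W: "amalg_words (G\<lparr>carrier := H\<rparr>) (G\<lparr>carrier := K\<rparr>) = W"
    by (simp add: amalg_words_def W_def)
  have HG: "H \<subseteq> carrier G" and KG: "K \<subseteq> carrier G"
    using H K by (auto dest: subgroup.subset)
  have letter: "case_sum id id l \<in> carrier G" if "l \<in> H <+> K" for l
    using that HG KG by auto
  have ev_Nil: "word_eval G [] = \<one>"
    and ev_Cons: "word_eval G (l # w) = case_sum id id l \<otimes> word_eval G w" for l w
    by (simp_all add: word_eval_def)
  have ev_closed: "word_eval G w \<in> carrier G" if "w \<in> W" for w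
    using that HG KG unfolding W_def by (rule word_eval_closed)
  have ev_append: "word_eval G (u @ v) = word_eval G u \<otimes> word_eval G v" if "u \<in> W" "v \<in> W" for u v
    using that unfolding W_def
    by (induction u) (use ev_closed in \<open>simp_all add: ev_Nil ev_Cons letter m_assoc W_def\<close>)
  have R_refl: "(w, w) \<in> R" if "w \<in> W" for w
    using that unfolding R_def by (intro amalg_rel.refl) (simp add: W)
  have R_sym: "(v, u) \<in> R" if "(u, v) \<in> R" for u v
    using that unfolding R_def by (rule amalg_rel.sym)
  have R_trans: "(u, w) \<in> R" if "(u, v) \<in> R" "(v, w) \<in> R" for u v w
    using that unfolding R_def by (rule amalg_rel.trans)
  have R_append: "(u @ v, u' @ v') \<in> R" if "(u, u') \<in> R" "(v, v') \<in> R" for u u' v v'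
    using that unfolding R_def by (rule amalg_rel.append)
  have R_mid: "(u @ v @ w, u @ v' @ w) \<in> R" if "(v, v') \<in> R" "u \<in> W" "w \<in> W" for u v v' w
    using that by (intro R_append R_refl)
  have R_inv: "u \<in> W \<and> v \<in> W \<and> word_eval G u = word_eval G v" if "(u, v) \<in> R" for u v
    using that unfolding R_def
  proof induction
    case (append u u' v v')
    then show ?case by (auto simp: ev_append) (auto simp: W_def)
  next
    case (refl w)
    then show ?case by (simp add: W)
  qed (use H K HG KG in \<open>auto simp: W_def ev_Nil ev_Cons subsetD m_assoc
         subgroup.one_closed subgroup.m_closed\<close>)
  have equiv: "equiv W R"
  proof (intro equivI refl_onI symI transI)
    show "R \<subseteq> W \<times> W" using R_inv by auto
  qed (fact R_refl R_sym R_trans)+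
  have R_one: "([l], []) \<in> R" if "case_sum id id l = \<one>" for l
    using that amalg_rel.one_left[of "G\<lparr>carrier := H\<rparr>" "G\<lparr>carrier := K\<rparr>" "H \<inter> K"]
      amalg_rel.one_right[of "G\<lparr>carrier := K\<rparr>" "G\<lparr>carrier := H\<rparr>" "H \<inter> K"]
    by (cases l) (auto simp: R_def)
  have R_multl: "([Inl a, Inl b], [Inl (a \<otimes> b)]) \<in> R" if "a \<in> H" "b \<in> H" for a b
    using amalg_rel.mult_left[of a "G\<lparr>carrier := H\<rparr>" b "G\<lparr>carrier := K\<rparr>" "H \<inter> K"] that
    by (simp add: R_def)
  have R_multr: "([Inr a, Inr b], [Inr (a \<otimes> b)]) \<in> R" if "a \<in> K" "b \<in> K" for a b
    using amalg_rel.mult_right[of a "G\<lparr>carrier := K\<rparr>" b "G\<lparr>carrier := H\<rparr>" "H \<inter> K"] that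
    by (simp add: R_def)
  have R_C: "([Inl c], [Inr c]) \<in> R" if "c \<in> H \<inter> K" for c
    unfolding R_def using that by (rule amalg_rel.amalg)
  have single: "[l] \<in> W" if "l \<in> H <+> K" for l
    using that by (simp add: W_def)
  have merge: "\<exists>l''. ([l, l'], [l'']) \<in> R"
    if l: "l \<in> H <+> K" "l' \<in> H <+> K"
      and "isl l = isl l' \<or> case_sum id id l \<in> H \<inter> K \<or> case_sum id id l' \<in> H \<inter> K" for l l'
  proof -
    have *: "\<exists>l''. ([Inl a, Inr b], [l'']) \<in> R" "\<exists>l''. ([Inr b, Inl a], [l'']) \<in> R"
      if "a \<in> H" "b \<in> K" "a \<in> H \<inter> K \<or> b \<in> H \<inter> K" for a b
    proof -
      have "([Inl a] @ [Inr b], [Inr a] @ [Inr b]) \<in> R \<and> ([Inr b] @ [Inl a], [Inr b] @ [Inr a]) \<in> R"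
        if "a \<in> H \<inter> K" using that \<open>b \<in> K\<close> R_C single by (intro conjI R_append R_refl) auto
      moreover have "([Inl a] @ [Inr b], [Inl a] @ [Inl b]) \<in> R \<and> ([Inr b] @ [Inl a], [Inl b] @ [Inl a]) \<in> R"
        if "b \<in> H \<inter> K" using that \<open>a \<in> H\<close> R_C single R_sym by (intro conjI R_append R_refl) auto
      ultimately show "\<exists>l''. ([Inl a, Inr b], [l'']) \<in> R" "\<exists>l''. ([Inr b, Inl a], [l'']) \<in> R"
        using that R_multl R_multr R_trans by (simp, blast)+
    qed
    have "\<exists>l''. ([Inl a, Inl b], [l'']) \<in> R" if "a \<in> H" "b \<in> H" for a b
      using R_multl[OF that] by blast
    moreover have "\<exists>l''. ([Inr a, Inr b], [l'']) \<in> R" if "a \<in> K" "b \<in> K" for a b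
      using R_multr[OF that] by blast
    ultimately show ?thesis
      using that * by (cases l; cases l') (auto simp: Plus_def)
  qed
  have trivial: "(w, []) \<in> R" if "w \<in> W" "word_eval G w = \<one>" for w
    using that
  proof (induction w rule: length_induct)
    case (1 w)
    show ?case
    proof (cases "length w \<ge> 2")
      case False
      then consider "w = []" | l where "w = [l]"
        by (cases w; cases "tl w") auto
      then show ?thesis
      proof cases
        case 1
        then show ?thesis using R_refl by (simp add: W_def)
      next
        case 2
        with 1 show ?thesis by (auto simp: ev_Cons ev_Nil W_def letter intro!: R_one)
      qed
    next
      case True
      then have "\<not> alternating (H \<inter> K) w"
        using alt[of w] 1 True by (cases "w = []") (auto simp: W_def)
      then obtain u l l' v where w: "w = u @ [l, l'] @ v"
        and l: "isl l = isl l' \<or> case_sum id id l \<in> H \<inter> K \<or> case_sum id id l' \<in> H \<inter> K"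
        using alternatingI[OF True, of "H \<inter> K"] by blast
      from w 1 have uv: "u \<in> W" "v \<in> W" "l \<in> H <+> K" "l' \<in> H <+> K"
        by (auto simp: W_def)
      with merge l obtain l'' where "([l, l'], [l'']) \<in> R" by blast
      then have "(w, u @ [l''] @ v) \<in> R" unfolding w using uv by (intro R_mid)
      moreover from R_inv[OF this] 1 have "(u @ [l''] @ v, []) \<in> R"
        by (intro 1(1)[rule_format]) (auto simp: w)
      ultimately show ?thesis by (rule R_trans)
    qed
  qed
  have inverse: "\<exists>w'\<in>W. (w' @ w, []) \<in> R" if "w \<in> W" for w
    using that
  proof (induction w)
    case Nil
    then show ?case using R_refl[of "[]"] by (auto simp: W_def)
  next
    case (Cons l w)
    then have l: "l \<in> H <+> K" and w: "w \<in> W" by (auto simp: W_def)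
    with Cons.IH obtain w' where w': "w' \<in> W" "(w' @ w, []) \<in> R" by blast
    define l' where "l' = map_sum (m_inv G) (m_inv G) l"
    have l': "l' \<in> H <+> K"
      using l H K by (auto simp: l'_def subgroup.m_inv_closed)
    have "([l', l], []) \<in> R"
      using l l' by (intro trivial)
        (auto simp: W_def ev_Cons ev_Nil l'_def subsetD[OF HG] subsetD[OF KG])
    with w w' have "(w' @ [l', l] @ w, w' @ [] @ w) \<in> R" by (intro R_mid)
    with w' have "((w' @ [l']) @ l # w, []) \<in> R" using R_trans by fastforce
    moreover have "w' @ [l'] \<in> W" using w' l' by (auto simp: W_def)
    ultimately show ?case by blast
  qed
  have faithful: "(u, v) \<in> R" if uv: "u \<in> W" "v \<in> W" "word_eval G u = word_eval G v" for u v
  proof -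
    obtain v' where v': "v' \<in> W" "(v' @ v, []) \<in> R" using inverse[OF uv(2)] by blast
    have "word_eval G v' \<otimes> word_eval G v = \<one>"
      using R_inv[OF v'(2)] v' uv by (simp add: ev_append ev_Nil)
    then have "word_eval G u \<otimes> word_eval G v' = \<one>"
      using uv v' ev_closed by (metis inv_comm)
    then have "(u @ v', []) \<in> R"
      using uv v' by (intro trivial) (auto simp: ev_append, auto simp: W_def)
    then have "((u @ v') @ v, [] @ v) \<in> R" using uv by (intro R_append R_refl)
    moreover have "(u @ v' @ v, u @ []) \<in> R" using uv v' by (intro R_append R_refl)
    ultimately show ?thesis using R_trans R_sym by (metis append.assoc append_Nil append_Nil2)
  qed
  have surj: "\<exists>w\<in>W. word_eval G w = g" if "g \<in> carrier G" for g
  proof -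
    from gen that have "g \<in> generate G (H \<union> K)" by blast
    then show ?thesis
    proof induction
      case one
      then show ?case by (intro bexI[of _ "[]"]) (auto simp: W_def ev_Nil)
    next
      case (incl h)
      then show ?case
        using HG KG by (intro bexI[of _ "[if h \<in> H then Inl h else Inr h]"])
          (auto simp: W_def ev_Nil ev_Cons)
    next
      case (inv h)
      moreover from inv have "inv h \<in> H \<union> K" using H K by (auto simp: subgroup.m_inv_closed)
      ultimately show ?case
        using HG KG by (intro bexI[of _ "[if inv h \<in> H then Inl (inv h) else Inr (inv h)]"])
          (auto simp: W_def ev_Nil ev_Cons)
    next
      case (eng g h)
      then obtain u v where "u \<in> W" "v \<in> W" "word_eval G u = g" "word_eval G v = h" by blast
      then show ?case by (intro bexI[of _ "u @ v"]) (simp_all add: ev_append, simp add: W_def)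
    qed
  qed
  define P where "P = amalg_product (G\<lparr>carrier := H\<rparr>) (G\<lparr>carrier := K\<rparr>) (H \<inter> K)"
  have P: "carrier P = W // R"
    by (simp add: P_def amalg_product_def W R_def)
  have nat: "amalg_natural G (R `` {w}) = word_eval G w" if "w \<in> W" for w
  proof -
    have "word_eval G w' = word_eval G w" if "w' \<in> R `` {w}" for w'
      using R_inv[of w w'] that by simp
    moreover have "w \<in> R `` {w}" using R_refl[OF that] by simp
    ultimately have "word_eval G ` (R `` {w}) = {word_eval G w}" by blast
    then show ?thesis by (simp add: amalg_natural_def)
  qed
  have P_mult: "(R `` {u}) \<otimes>\<^bsub>P\<^esub> (R `` {v}) = R `` {u @ v}" if "u \<in> W" "v \<in> W" for u v
  proof -
    have "R `` {u' @ v'} = R `` {u @ v}" if "(u, u') \<in> R" "(v, v') \<in> R" for u' v'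
      using equiv_class_eq[OF equiv R_append[OF that]] by simp
    then have "(\<Union>u'\<in>R `` {u}. \<Union>v'\<in>R `` {v}. R `` {u' @ v'}) = R `` {u @ v}"
      using R_refl[OF \<open>u \<in> W\<close>] R_refl[OF \<open>v \<in> W\<close>] by blast
    then show ?thesis by (simp add: P_def amalg_product_def R_def)
  qed
  have append: "u @ v \<in> W" if "u \<in> W" "v \<in> W" for u v using that by (simp add: W_def)
  have "amalg_natural G \<in> iso P G"
  proof (rule isoI)
    have cls: "\<exists>w\<in>W. X = R `` {w}" if "X \<in> carrier P" for X
      using that unfolding P by (blast elim: quotientE)
    show "amalg_natural G \<in> hom P G"
    proof (rule homI)
      fix X Y assume "X \<in> carrier P" "Y \<in> carrier P"
      then obtain u v where "u \<in> W" "X = R `` {u}" "v \<in> W" "Y = R `` {v}"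
        using cls by meson
      then show "amalg_natural G X \<in> carrier G"
        "amalg_natural G (X \<otimes>\<^bsub>P\<^esub> Y) = amalg_natural G X \<otimes> amalg_natural G Y"
        by (simp_all only: P_mult nat append ev_closed ev_append)
    qed
    have "inj_on (amalg_natural G) (carrier P)"
    proof (rule inj_onI)
      fix X Y assume "X \<in> carrier P" "Y \<in> carrier P" and eq: "amalg_natural G X = amalg_natural G Y"
      then obtain u v where uv: "u \<in> W" "X = R `` {u}" "v \<in> W" "Y = R `` {v}"
        using cls by meson
      with eq have "word_eval G u = word_eval G v" by (simp only: nat)
      from equiv_class_eq[OF equiv faithful[OF uv(1,3) this]] show "X = Y"
        by (simp only: uv(2,4))
    qed
    moreover have "amalg_natural G ` carrier P = word_eval G ` W"
    proof -
      have "carrier P = (\<lambda>w. R `` {w}) ` W" unfolding P quotient_def by blast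
      then show ?thesis using nat by (simp only: image_image cong: image_cong)
    qed
    moreover have "word_eval G ` W = carrier G"
      using surj ev_closed by auto
    ultimately show "bij_betw (amalg_natural G) (carrier P) (carrier G)"
      by (simp add: bij_betw_def)
  qed
  then show ?thesis
    using assms by (simp add: is_amalgamated_free_product_def P_def)
qed

section \<open>Differential homomorphisms\<close>

lemma Const_add: "Const (a + b) = Const a + (Const b :: ('d, 'k::comm_ring_1) dpoly)"
  by (simp add: Const_def single_add)

lemma Const_mult: "Const (a * b) = Const a * (Const b :: ('d, 'k::comm_ring_1) dpoly)"
  by (simp add: Const_def mult_single)

lemma Const_0: "Const 0 = (0 :: ('d, 'k::comm_ring_1) dpoly)"
  by (simp add: Const_def)

lemma Const_1: "Const 1 = (1 :: ('d, 'k::comm_ring_1) dpoly)"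
  by (simp add: Const_def)

lemma Const_uminus: "Const (- a) = - (Const a :: ('d, 'k::comm_ring_1) dpoly)"
  by (simp add: Const_def single_uminus)

lemma vars_add: "vars (p + q :: ('d, 'k::comm_ring_1) dpoly) \<subseteq> vars p \<union> vars q"
  using Poly_Mapping.keys_add[of p q] by (auto simp: vars_def)

lemma vars_mult: "vars (p * q :: ('d, 'k::comm_ring_1) dpoly) \<subseteq> vars p \<union> vars q"
proof
  fix v assume "v \<in> vars (p * q)"
  then obtain m where "m \<in> Poly_Mapping.keys (p * q)" "v \<in> Poly_Mapping.keys m"
    by (auto simp: vars_def)
  moreover from this obtain a b where "m = a + b" "a \<in> Poly_Mapping.keys p" "b \<in> Poly_Mapping.keys q"
    using Poly_Mapping.keys_mult[of p q] by blast
  ultimately show "v \<in> vars p \<union> vars q"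
    using Poly_Mapping.keys_add[of a b] by (auto simp: vars_def)
qed

lemma vars_single: "vars (Poly_Mapping.single m c) \<subseteq> Poly_Mapping.keys m"
  by (auto simp: vars_def)

lemma vars_Const: "vars (Const c :: ('d, 'k::comm_ring_1) dpoly) = {}"
  by (auto simp: vars_def Const_def)

lemma vars_Var: "vars (Var v :: ('d, 'k::comm_ring_1) dpoly) = {v}"
  by (auto simp: vars_def Var_def)

lemma vars_dderiv: "vars (dderiv D d p) \<subseteq> vars p \<union> dshift d ` vars p"
proof -
  have "vars (dterm D d m c) \<subseteq> Poly_Mapping.keys m \<union> dshift d ` Poly_Mapping.keys m" for m c
  proof -
    have "Poly_Mapping.keys (m - Poly_Mapping.single v 1 + Poly_Mapping.single (dshift d v) 1)
        \<subseteq> Poly_Mapping.keys m \<union> dshift d ` Poly_Mapping.keys m" if "v \<in> Poly_Mapping.keys m" for v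
      using that by (intro order.trans[OF Poly_Mapping.keys_add]) (auto simp: in_keys_iff lookup_minus)
    then show ?thesis
      unfolding dterm_def
      by (intro order.trans[OF vars_add] Un_least order.trans[OF vars_sum] UN_least
          order.trans[OF vars_single]) auto
  qed
  moreover have "Poly_Mapping.keys m \<subseteq> vars p" if "m \<in> Poly_Mapping.keys p" for m
    using that by (auto simp: vars_def)
  ultimately show ?thesis
    unfolding dderiv_def by (intro order.trans[OF vars_sum] UN_least) blast
qed

lemma Var_power:
  "(Var v :: ('d, 'k::comm_ring_1) dpoly) ^ n = Poly_Mapping.single (Poly_Mapping.single v n) 1"
  by (induction n) (simp_all add: Var_def mult_single single_add[symmetric])

lemma prod_single:
  "(\<Prod>i\<in>S. Poly_Mapping.single (f i) 1) =
     (Poly_Mapping.single (\<Sum>i\<in>S. f i) 1 :: ('d, 'k::comm_ring_1) dpoly)"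
  by (induction S rule: infinite_finite_induct) (simp_all add: mult_single)

lemma single_eq_prod:
  "Poly_Mapping.single m c =
     Const c * (\<Prod>v\<in>Poly_Mapping.keys m. Var v ^ Poly_Mapping.lookup m v
       :: ('d, 'k::comm_ring_1) dpoly)"
proof -
  have "(\<Sum>v\<in>Poly_Mapping.keys m. Poly_Mapping.single v (Poly_Mapping.lookup m v)) = m"
    by (rule poly_mapping_eqI) (auto simp: lookup_sum lookup_single when_def in_keys_iff)
  then show ?thesis
    by (simp add: Var_power prod_single Const_def mult_single)
qed

text \<open>
  The variables \<open>z\<^sup>\<theta>\<close> are treated as unrelated here; the substitution respects derivations only
  for assignments that send \<open>z\<^sup>\<theta>\<close> to \<open>\<theta>\<close> of the value of \<open>z\<close>, see \<open>dhom_exists\<close>.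
\<close>

definition peval :: "('d dvar \<Rightarrow> ('d, 'k) dpoly) \<Rightarrow> ('d, 'k::comm_ring_1) dpoly \<Rightarrow> ('d, 'k) dpoly" where
  "peval \<sigma> p = (\<Sum>m\<in>Poly_Mapping.keys p.
     Const (Poly_Mapping.lookup p m) * (\<Prod>v\<in>Poly_Mapping.keys m. \<sigma> v ^ Poly_Mapping.lookup m v))"

lemma peval_superset:
  assumes "finite S" "Poly_Mapping.keys p \<subseteq> S"
  shows "peval \<sigma> p = (\<Sum>m\<in>S.
     Const (Poly_Mapping.lookup p m) * (\<Prod>v\<in>Poly_Mapping.keys m. \<sigma> v ^ Poly_Mapping.lookup m v))"
  unfolding peval_def using assms
  by (intro sum.mono_neutral_left) (auto simp: in_keys_iff Const_0)

lemma peval_add: "peval \<sigma> (p + q) = peval \<sigma> p + peval \<sigma> q"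
proof -
  let ?S = "Poly_Mapping.keys p \<union> Poly_Mapping.keys q"
  show ?thesis
    using Poly_Mapping.keys_add[of p q]
    by (simp add: peval_superset[of ?S] lookup_add Const_add distrib_right sum.distrib)
qed

lemma peval_sum: "peval \<sigma> (\<Sum>i\<in>I. f i) = (\<Sum>i\<in>I. peval \<sigma> (f i))"
  by (induction I rule: infinite_finite_induct) (simp_all add: peval_add, simp_all add: peval_def)

lemma monom_value_add:
  "(\<Prod>v\<in>Poly_Mapping.keys (m + n). \<sigma> v ^ Poly_Mapping.lookup (m + n) v) =
   (\<Prod>v\<in>Poly_Mapping.keys m. \<sigma> v ^ Poly_Mapping.lookup m v) *
   (\<Prod>v\<in>Poly_Mapping.keys n. \<sigma> v ^ Poly_Mapping.lookup n v :: 'a::comm_ring_1)"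
proof -
  let ?S = "Poly_Mapping.keys m \<union> Poly_Mapping.keys n"
  have *: "(\<Prod>v\<in>Poly_Mapping.keys m. \<sigma> v ^ Poly_Mapping.lookup m v) =
      (\<Prod>v\<in>?S. \<sigma> v ^ Poly_Mapping.lookup m v)" if "Poly_Mapping.keys m \<subseteq> ?S" for m
    using that by (intro prod.mono_neutral_left) (auto simp: in_keys_iff)
  show ?thesis
    unfolding *[OF Poly_Mapping.keys_add] *[OF Un_upper1] *[OF Un_upper2]
    by (simp add: lookup_add power_add prod.distrib)
qed

lemma peval_single:
  "peval \<sigma> (Poly_Mapping.single m c) =
     Const c * (\<Prod>v\<in>Poly_Mapping.keys m. \<sigma> v ^ Poly_Mapping.lookup m v)"
  by (subst peval_superset[of "{m}"]) auto

lemma peval_mult: "peval \<sigma> (p * q) = peval \<sigma> p * peval \<sigma> q"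
proof -
  let ?s = "\<lambda>p m. Poly_Mapping.single m (Poly_Mapping.lookup p m) :: ('a, 'b) dpoly"
  have "peval \<sigma> (?s p m * ?s q n) = peval \<sigma> (?s p m) * peval \<sigma> (?s q n)" for m n
    by (simp only: mult_single peval_single monom_value_add Const_mult mult.assoc mult.left_commute)
  then have "peval \<sigma> ((\<Sum>m\<in>Poly_Mapping.keys p. ?s p m) * (\<Sum>n\<in>Poly_Mapping.keys q. ?s q n)) =
      peval \<sigma> (\<Sum>m\<in>Poly_Mapping.keys p. ?s p m) * peval \<sigma> (\<Sum>n\<in>Poly_Mapping.keys q. ?s q n)"
    by (simp only: sum_product peval_sum)
  then show ?thesis
    unfolding dpoly_eq_sum_single[of p, symmetric] dpoly_eq_sum_single[of q, symmetric] .
qed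

lemma peval_Const: "peval \<sigma> (Const c) = Const c"
  by (simp add: Const_def peval_single)

lemma peval_Var: "peval \<sigma> (Var v) = \<sigma> v"
  by (simp add: Var_def peval_single Const_1)

definition affine :: "'k::field \<Rightarrow> 'k \<Rightarrow> 'k \<Rightarrow> ('d, 'k) dpoly" where
  "affine a b c = Const a * vx + Const b * vy + Const c"

lemma affine_combination:
  "Const a * affine a1 b1 c1 + Const b * affine a2 b2 c2 + Const c =
     affine (a * a1 + b * a2) (a * b1 + b * b2) (a * c1 + b * c2 + c)"
  by (simp add: affine_def Const_add Const_mult algebra_simps)

lemma affine_cong: "a = a' \<Longrightarrow> b = b' \<Longrightarrow> c = c' \<Longrightarrow> affine a b c = affine a' b' c'"
  by simp

lemma affine_vars: "affine 1 0 0 = vx" "affine 0 1 0 = vy"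
  by (simp_all add: affine_def Const_0 Const_1)

locale diff_field =
  fixes \<Delta> :: "'d set" and D :: "'d \<Rightarrow> 'k::field_char_0 \<Rightarrow> 'k"
  assumes fin: "finite \<Delta>" and diff: "differential_ring \<Delta> D"
begin

lemma D_add: "d \<in> \<Delta> \<Longrightarrow> D d (a + b) = D d a + D d b"
  and D_mult: "d \<in> \<Delta> \<Longrightarrow> D d (a * b) = D d a * b + a * D d b"
  using diff by (auto simp: differential_ring_def)

lemma D_0: "d \<in> \<Delta> \<Longrightarrow> D d 0 = 0" and D_1: "d \<in> \<Delta> \<Longrightarrow> D d 1 = 0"
  using D_add[of d 0 0] D_mult[of d 1 1] by simp_all

lemma dd_add: "d \<in> \<Delta> \<Longrightarrow> dderiv D d (p + q) = dderiv D d p + dderiv D d q"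
  by (intro dderiv_add D_add)

lemma dd_mult: "d \<in> \<Delta> \<Longrightarrow> dderiv D d (p * q) = dderiv D d p * q + p * dderiv D d q"
  by (intro dderiv_mult D_add D_mult)

lemma dd_Const: "d \<in> \<Delta> \<Longrightarrow> dderiv D d (Const c) = Const (D d c)"
  by (intro dderiv_Const D_0)

lemma dd_Var: "d \<in> \<Delta> \<Longrightarrow> dderiv D d (Var v) = Var (dshift d v)"
  by (intro dderiv_Var D_0 D_1)

text \<open>
  The algebras \<open>k{x,y}\<close> and \<open>k{z}\<close> are the cases \<open>Z = UNIV\<close> and \<open>Z = {z}\<close>; treating them as members
  of one family lets a single induction principle serve for both.
\<close>

definition polys :: "gen set \<Rightarrow> ('d, 'k) dpoly set" where
  "polys Z = {p. vars p \<subseteq> Z \<times> Theta \<Delta>}"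

lemma dpolys_eq: "dpolys \<Delta> = polys UNIV" and dpolys1_eq: "dpolys1 \<Delta> z = polys {z}"
  by (simp_all add: polys_def dpolys_def dpolys1_def)

lemma polys_mono: "Y \<subseteq> Z \<Longrightarrow> polys Y \<subseteq> polys Z"
  by (auto simp: polys_def)

lemma polys_add: "p \<in> polys Z \<Longrightarrow> q \<in> polys Z \<Longrightarrow> p + q \<in> polys Z"
  and polys_mult: "p \<in> polys Z \<Longrightarrow> q \<in> polys Z \<Longrightarrow> p * q \<in> polys Z"
  using vars_add[of p q] vars_mult[of p q] by (auto simp: polys_def)

lemma polys_Const: "Const c \<in> polys Z"
  by (simp add: polys_def vars_Const)

lemma polys_Var: "Var v \<in> polys Z \<longleftrightarrow> v \<in> Z \<times> Theta \<Delta>"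
  by (simp add: polys_def vars_Var)

lemma Theta_0: "0 \<in> Theta \<Delta>"
  by (simp add: Theta_def)

lemma Theta_shift: "\<theta> \<in> Theta \<Delta> \<Longrightarrow> d \<in> \<Delta> \<Longrightarrow> \<theta> + Poly_Mapping.single d 1 \<in> Theta \<Delta>"
  using Poly_Mapping.keys_add[of \<theta> "Poly_Mapping.single d 1"] by (auto simp: Theta_def)

lemma polys_dderiv: "d \<in> \<Delta> \<Longrightarrow> p \<in> polys Z \<Longrightarrow> dderiv D d p \<in> polys Z"
proof -
  assume d: "d \<in> \<Delta>" and p: "p \<in> polys Z"
  have "dshift d ` vars p \<subseteq> Z \<times> Theta \<Delta>"
    using p Theta_shift[OF _ d] by (fastforce simp: polys_def dshift_def)
  with p show ?thesis
    using vars_dderiv[of D d p] unfolding polys_def by blast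
qed

lemma polys_power: "p \<in> polys Z \<Longrightarrow> p ^ n \<in> polys Z"
  by (induction n) (use polys_Const[of 1 Z] in \<open>auto simp: Const_1 intro: polys_mult\<close>)

lemma polys_prod: "(\<And>i. i \<in> I \<Longrightarrow> f i \<in> polys Z) \<Longrightarrow> (\<Prod>i\<in>I. f i) \<in> polys Z"
  by (induction I rule: infinite_finite_induct)
    (use polys_Const[of 1 Z] in \<open>auto simp: Const_1 intro: polys_mult\<close>)

lemma polys_sum: "(\<And>i. i \<in> I \<Longrightarrow> f i \<in> polys Z) \<Longrightarrow> (\<Sum>i\<in>I. f i) \<in> polys Z"
  by (induction I rule: infinite_finite_induct)
    (use polys_Const[of 0 Z] in \<open>auto simp: Const_0 intro: polys_add\<close>)

lemma polys_vx: "GX \<in> Z \<Longrightarrow> vx \<in> polys Z" and polys_vy: "GY \<in> Z \<Longrightarrow> vy \<in> polys Z"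
  by (simp_all add: vx_def vy_def polys_Var Theta_0)

lemma affine_polys: "affine a b c \<in> polys UNIV"
  by (simp add: affine_def polys_add polys_mult polys_Const polys_vx polys_vy)

lemma Theta_induct [consumes 1, case_names zero shift]:
  assumes "\<theta> \<in> Theta \<Delta>" and zero: "P 0"
    and shift: "\<And>\<theta> d. \<theta> \<in> Theta \<Delta> \<Longrightarrow> d \<in> \<Delta> \<Longrightarrow> P \<theta> \<Longrightarrow> P (\<theta> + Poly_Mapping.single d 1)"
  shows "P \<theta>"
  using assms(1)
proof (induction "\<Sum>d\<in>\<Delta>. Poly_Mapping.lookup \<theta> d" arbitrary: \<theta>)
  case 0
  then have "\<theta> = 0"
    using fin by (intro poly_mapping_eqI) (auto simp: Theta_def in_keys_iff)
  with zero show ?case by simp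
next
  case (Suc n)
  then obtain d where d: "d \<in> \<Delta>" "Poly_Mapping.lookup \<theta> d \<noteq> 0"
    by (metis sum.neutral Zero_not_Suc)
  define \<eta> where "\<eta> = \<theta> - Poly_Mapping.single d 1"
  have \<theta>: "\<theta> = \<eta> + Poly_Mapping.single d 1"
    using d by (intro poly_mapping_eqI) (auto simp: \<eta>_def lookup_add lookup_minus lookup_single when_def)
  have "\<eta> \<in> Theta \<Delta>"
    using Suc.prems by (auto simp: Theta_def \<eta>_def in_keys_iff lookup_minus)
  moreover have "n = (\<Sum>d\<in>\<Delta>. Poly_Mapping.lookup \<eta> d)"
    using Suc.hyps(2) d(1) fin by (simp add: \<theta> lookup_add sum.distrib lookup_single when_def)
  ultimately show ?case
    unfolding \<theta> using d(1) by (intro shift Suc.hyps(1))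
qed

text \<open>
  As a differential algebra, \<open>polys Z\<close> is generated by the symbols in \<open>Z\<close>. This gives at once that
  a differential homomorphism is determined by the images of \<open>x\<close> and \<open>y\<close> (\<open>dhom_unique\<close>), and that
  it maps \<open>k{y}\<close> to itself if it does so with \<open>y\<close> (\<open>dhom_polys\<close>).
\<close>

lemma polys_induct [consumes 1, case_names Const Var add mult deriv]:
  assumes "p \<in> polys Z" and C: "\<And>c. P (Const c)" and V: "\<And>z. z \<in> Z \<Longrightarrow> P (Var (z, 0))"
    and A: "\<And>p q. p \<in> polys Z \<Longrightarrow> q \<in> polys Z \<Longrightarrow> P p \<Longrightarrow> P q \<Longrightarrow> P (p + q)"
    and M: "\<And>p q. p \<in> polys Z \<Longrightarrow> q \<in> polys Z \<Longrightarrow> P p \<Longrightarrow> P q \<Longrightarrow> P (p * q)"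
    and DD: "\<And>d p. d \<in> \<Delta> \<Longrightarrow> p \<in> polys Z \<Longrightarrow> P p \<Longrightarrow> P (dderiv D d p)"
  shows "P p"
proof -
  have "P (Var (z, \<theta>))" if "\<theta> \<in> Theta \<Delta>" "z \<in> Z" for z \<theta>
    using that
  proof (induction \<theta> rule: Theta_induct)
    case zero
    then show ?case by (rule V)
  next
    case (shift \<theta> d)
    then have "P (dderiv D d (Var (z, \<theta>)))"
      by (intro DD) (auto simp: polys_Var)
    with shift show ?case by (simp add: dd_Var dshift_def)
  qed
  then have var: "P (Var v)" if "v \<in> Z \<times> Theta \<Delta>" for v
    using that by (cases v) auto
  have pow: "P (Var v ^ n)" if "v \<in> Z \<times> Theta \<Delta>" for v n
    using that by (induction n) (use C[of 1] in \<open>auto simp: Const_1 polys_Var intro!: M var polys_power\<close>)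
  have prod: "P (\<Prod>v\<in>S. Var v ^ f v)" if "S \<subseteq> Z \<times> Theta \<Delta>" for S f
    using that by (induction S rule: infinite_finite_induct)
      (use C[of 1] in \<open>auto simp: Const_1 intro!: M pow polys_power polys_prod, auto simp: polys_Var\<close>)
  have keys: "Poly_Mapping.keys m \<subseteq> Z \<times> Theta \<Delta>" if "m \<in> Poly_Mapping.keys p" for m
    using assms(1) that by (auto simp: polys_def vars_def)
  have sing: "Poly_Mapping.single m c \<in> polys Z \<and> P (Poly_Mapping.single m c)"
    if "m \<in> Poly_Mapping.keys p" for m c
    using keys[OF that] unfolding single_eq_prod
    by (intro conjI M prod C polys_mult polys_Const polys_prod polys_power) (auto simp: polys_Var)
  have "P (\<Sum>m\<in>S. Poly_Mapping.single m (Poly_Mapping.lookup p m))"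
    if "S \<subseteq> Poly_Mapping.keys p" for S
    using that by (induction S rule: infinite_finite_induct)
      (use C[of 0] sing in \<open>auto simp: Const_0 intro!: A polys_sum\<close>)
  from this[of "Poly_Mapping.keys p"] show ?thesis
    by (simp only: dpoly_eq_sum_single[symmetric] subset_refl)
qed

definition dhom :: "(('d, 'k) dpoly \<Rightarrow> ('d, 'k) dpoly) \<Rightarrow> bool" where
  "dhom \<phi> \<longleftrightarrow> \<phi> \<in> polys UNIV \<rightarrow> polys UNIV \<and>
     (\<forall>p\<in>polys UNIV. \<forall>q\<in>polys UNIV. \<phi> (p + q) = \<phi> p + \<phi> q \<and> \<phi> (p * q) = \<phi> p * \<phi> q) \<and>
     (\<forall>c. \<phi> (Const c) = Const c) \<and>
     (\<forall>d\<in>\<Delta>. \<forall>p\<in>polys UNIV. \<phi> (dderiv D d p) = dderiv D d (\<phi> p))"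

lemma auts_eq: "auts \<Delta> D = {\<phi> \<in> Bij (polys UNIV). dhom \<phi>}"
  using Bij_imp_funcset[of _ "polys UNIV"] by (auto simp: auts_def dhom_def dpolys_eq)

context
  fixes \<phi> assumes \<phi>: "dhom \<phi>"
begin

lemma dhom_closed: "p \<in> polys UNIV \<Longrightarrow> \<phi> p \<in> polys UNIV"
  and dhom_add: "p \<in> polys UNIV \<Longrightarrow> q \<in> polys UNIV \<Longrightarrow> \<phi> (p + q) = \<phi> p + \<phi> q"
  and dhom_mult: "p \<in> polys UNIV \<Longrightarrow> q \<in> polys UNIV \<Longrightarrow> \<phi> (p * q) = \<phi> p * \<phi> q"
  and dhom_Const: "\<phi> (Const c) = Const c"
  and dhom_dderiv: "d \<in> \<Delta> \<Longrightarrow> p \<in> polys UNIV \<Longrightarrow> \<phi> (dderiv D d p) = dderiv D d (\<phi> p)"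
  using \<phi> by (auto simp: dhom_def)

lemma dhom_power: "p \<in> polys UNIV \<Longrightarrow> \<phi> (p ^ n) = \<phi> p ^ n"
  using dhom_Const[of 1] by (induction n) (simp_all add: Const_1 dhom_mult polys_power)

lemma dhom_prod: "(\<And>i. i \<in> I \<Longrightarrow> f i \<in> polys UNIV) \<Longrightarrow> \<phi> (\<Prod>i\<in>I. f i) = (\<Prod>i\<in>I. \<phi> (f i))"
  using dhom_Const[of 1]
  by (induction I rule: infinite_finite_induct) (simp_all add: Const_1 dhom_mult polys_prod)

lemma dhom_sum: "(\<And>i. i \<in> I \<Longrightarrow> f i \<in> polys UNIV) \<Longrightarrow> \<phi> (\<Sum>i\<in>I. f i) = (\<Sum>i\<in>I. \<phi> (f i))"
  using dhom_Const[of 0]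
  by (induction I rule: infinite_finite_induct) (simp_all add: Const_0 dhom_add polys_sum)

lemma dhom_polys:
  assumes "p \<in> polys Z" "\<And>z. z \<in> Z \<Longrightarrow> \<phi> (Var (z, 0)) \<in> polys Y"
  shows "\<phi> p \<in> polys Y"
  using assms(1)
  by (induction p rule: polys_induct)
    (use assms(2) polys_mono[of Z UNIV] in \<open>auto simp: dhom_add dhom_mult dhom_Const dhom_dderiv subsetD
       intro: polys_add polys_mult polys_Const polys_dderiv\<close>)

lemma dhom_affine: "\<phi> (affine a b c) = Const a * \<phi> vx + Const b * \<phi> vy + Const c"
  by (simp add: affine_def dhom_add dhom_mult dhom_Const polys_Const polys_vx polys_vy
      polys_add polys_mult)

end

lemma dhom_unique:
  assumes "dhom \<phi>" "dhom \<psi>" "\<phi> vx = \<psi> vx" "\<phi> vy = \<psi> vy" "p \<in> polys UNIV"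
  shows "\<phi> p = \<psi> p"
  using assms(5)
proof (induction p rule: polys_induct)
  case (Var z)
  then show ?case using assms by (cases z) (auto simp: vx_def vy_def)
qed (use assms in \<open>auto simp: dhom_Const dhom_add dhom_mult dhom_dderiv\<close>)

lemma dhom_id: "dhom (\<lambda>p. p)"
  by (simp add: dhom_def)

lemma dhom_comp: "dhom \<phi> \<Longrightarrow> dhom \<psi> \<Longrightarrow> dhom (\<lambda>p. \<phi> (\<psi> p))"
  by (auto simp: dhom_def Pi_iff)

lemma dhom_cong: "dhom \<phi> \<Longrightarrow> (\<And>p. p \<in> polys UNIV \<Longrightarrow> \<psi> p = \<phi> p) \<Longrightarrow> dhom \<psi>"
  by (auto simp: dhom_def Pi_iff polys_add polys_mult polys_Const polys_dderiv)

text \<open>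
  The list enumerates the derivation symbols and fixes the order in which they are applied. Since the
  derivations commute, the order has no influence on how the operator changes when \<open>\<theta>\<close> is
  multiplied by a further symbol, wherever that symbol stands in the list (\<open>theta_shift\<close>).
\<close>

definition theta :: "'d list \<Rightarrow> ('d \<Rightarrow>\<^sub>0 nat) \<Rightarrow> ('d, 'k) dpoly \<Rightarrow> ('d, 'k) dpoly" where
  "theta ds \<theta> p = foldr (\<lambda>d. dderiv D d ^^ Poly_Mapping.lookup \<theta> d) ds p"

lemma theta_shift:
  assumes "set ds \<subseteq> \<Delta>" "distinct ds" "d \<in> \<Delta>"
  shows "theta ds (\<theta> + Poly_Mapping.single d 1) p =
    (if d \<in> set ds then dderiv D d (theta ds \<theta> p) else theta ds \<theta> p)"
  using assms
proof (induction ds)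
  case (Cons e ds)
  have comm: "(dderiv D e ^^ n) (dderiv D d q) = dderiv D d ((dderiv D e ^^ n) q)" for n q
    using Cons.prems by (induction n) (simp_all add: dderiv_commute[OF diff])
  show ?case
    using Cons by (auto simp: theta_def lookup_add lookup_single when_def comm)
qed (simp add: theta_def)

lemma theta_closed: "set ds \<subseteq> \<Delta> \<Longrightarrow> p \<in> polys Z \<Longrightarrow> theta ds \<theta> p \<in> polys Z"
proof (induction ds)
  case (Cons e ds)
  have "(dderiv D e ^^ n) q \<in> polys Z" if "q \<in> polys Z" for n q
    using that Cons.prems by (induction n) (auto intro: polys_dderiv)
  with Cons show ?case by (simp add: theta_def)
qed (simp add: theta_def)

text \<open>
  The universal property of the algebra of differential polynomials. The only possible choice sends
  \<open>z\<^sup>\<theta>\<close> to \<open>\<theta>\<close> of the image of \<open>z\<close>. The coefficients matter here: for example \<open>\<theta>(a x)\<close> is in general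
  not \<open>a x\<^sup>\<theta>\<close>, so the images of all variables have to be computed with the operators \<open>\<theta>\<close>, even for
  linear substitutions.
\<close>

lemma dhom_exists:
  assumes "f \<in> polys UNIV" "g \<in> polys UNIV"
  shows "\<exists>\<phi>. dhom \<phi> \<and> \<phi> vx = f \<and> \<phi> vy = g"
proof -
  obtain ds where ds: "set ds = \<Delta>" "distinct ds"
    using fin finite_distinct_list by blast
  define \<sigma> where "\<sigma> v = theta ds (snd v) (case fst v of GX \<Rightarrow> f | GY \<Rightarrow> g)" for v
  have \<sigma>_closed: "\<sigma> v \<in> polys UNIV" for v
    using assms ds(1) theta_closed[of ds _ UNIV] by (simp add: \<sigma>_def split: gen.split)
  have shift: "\<sigma> (dshift d v) = dderiv D d (\<sigma> v)" if "d \<in> \<Delta>" for d v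
    using that ds theta_shift[of ds d] by (simp add: \<sigma>_def dshift_def)
  have closed: "peval \<sigma> p \<in> polys UNIV" for p
    unfolding peval_def
    by (intro polys_sum polys_mult polys_Const polys_prod polys_power \<sigma>_closed)
  have "peval \<sigma> (dderiv D d p) = dderiv D d (peval \<sigma> p)" if "d \<in> \<Delta>" for d p
    by (induction p rule: dpoly_induct)
      (use that in \<open>simp_all add: dd_Const dd_Var dd_add dd_mult peval_Const peval_Var peval_add
         peval_mult shift\<close>)
  then have "dhom (peval \<sigma>)"
    using closed by (simp add: dhom_def peval_add peval_mult peval_Const)
  moreover have "theta ds 0 p = p" for p
    unfolding theta_def by (induction ds) simp_all
  then have "peval \<sigma> vx = f" "peval \<sigma> vy = g"
    by (simp_all add: vx_def vy_def peval_Var \<sigma>_def)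
  ultimately show ?thesis by blast
qed

text \<open>
  The inverse substitution is read off from the inverse matrix. Both composites fix \<open>x\<close> and \<open>y\<close>, hence
  are the identity by \<open>dhom_unique\<close>.
\<close>

lemma affine_aut_exists:
  assumes "a1 * b2 \<noteq> a2 * b1"
  shows "\<exists>\<phi>\<in>auts \<Delta> D. \<phi> vx = affine a1 b1 c1 \<and> \<phi> vy = affine a2 b2 c2"
proof -
  define e where "e = a1 * b2 - a2 * b1"
  have e: "e \<noteq> 0" using assms by (simp add: e_def)
  obtain \<phi> where \<phi>: "dhom \<phi>" "\<phi> vx = affine a1 b1 c1" "\<phi> vy = affine a2 b2 c2"
    using dhom_exists affine_polys by metis
  obtain \<psi> where \<psi>: "dhom \<psi>"
    "\<psi> vx = affine (b2 / e) (- b1 / e) ((b1 * c2 - b2 * c1) / e)"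
    "\<psi> vy = affine (- a2 / e) (a1 / e) ((a2 * c1 - a1 * c2) / e)"
    using dhom_exists affine_polys by metis
  have "\<phi> (\<psi> vx) = affine 1 0 0"
    unfolding \<psi>(2,3) dhom_affine[OF \<phi>(1)] \<phi>(2,3) affine_combination
    by (rule affine_cong; (use e in \<open>simp add: field_simps\<close>); (simp add: e_def algebra_simps)?)
  moreover have "\<phi> (\<psi> vy) = affine 0 1 0"
    unfolding \<psi>(2,3) dhom_affine[OF \<phi>(1)] \<phi>(2,3) affine_combination
    by (rule affine_cong; (use e in \<open>simp add: field_simps\<close>); (simp add: e_def algebra_simps)?)
  ultimately have 1: "\<phi> (\<psi> p) = p" if "p \<in> polys UNIV" for p
    using dhom_unique[OF dhom_comp[OF \<phi>(1) \<psi>(1)] dhom_id _ _ that] by (simp add: affine_vars)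
  have "\<psi> (\<phi> vx) = affine 1 0 0"
    unfolding \<phi>(2,3) dhom_affine[OF \<psi>(1)] \<psi>(2,3) affine_combination
    by (rule affine_cong; (use e in \<open>simp add: field_simps\<close>); (simp add: e_def algebra_simps)?)
  moreover have "\<psi> (\<phi> vy) = affine 0 1 0"
    unfolding \<phi>(2,3) dhom_affine[OF \<psi>(1)] \<psi>(2,3) affine_combination
    by (rule affine_cong; (use e in \<open>simp add: field_simps\<close>); (simp add: e_def algebra_simps)?)
  ultimately have 2: "\<psi> (\<phi> p) = p" if "p \<in> polys UNIV" for p
    using dhom_unique[OF dhom_comp[OF \<psi>(1) \<phi>(1)] dhom_id _ _ that] by (simp add: affine_vars)
  have "bij_betw \<phi> (polys UNIV) (polys UNIV)"
    using 1 2 \<phi>(1) \<psi>(1) by (intro bij_betw_byWitness[where f' = \<psi>]) (auto dest: dhom_closed)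
  then have "restrict \<phi> (polys UNIV) \<in> auts \<Delta> D"
    using \<phi>(1) by (auto simp: auts_eq Bij_def intro: dhom_cong)
  with \<phi>(2,3) show ?thesis
    by (intro bexI[of _ "restrict \<phi> (polys UNIV)"]) (simp_all add: polys_vx polys_vy)
qed

end

section \<open>Affine, triangular and tame automorphisms\<close>

context diff_field
begin

lemma autsD: "\<phi> \<in> auts \<Delta> D \<Longrightarrow> dhom \<phi>"
  by (simp add: auts_eq)

lemma BijGroup_apply:
  "\<phi> \<in> Bij S \<Longrightarrow> \<psi> \<in> Bij S \<Longrightarrow> p \<in> S \<Longrightarrow> (\<phi> \<otimes>\<^bsub>BijGroup S\<^esub> \<psi>) p = \<phi> (\<psi> p)"
  by (simp add: BijGroup_def compose_def)

lemma dhom_inverse: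
  assumes "dhom \<phi>" and \<psi>: "\<psi> \<in> polys UNIV \<rightarrow> polys UNIV"
    and inv: "\<And>p. p \<in> polys UNIV \<Longrightarrow> \<psi> (\<phi> p) = p" "\<And>p. p \<in> polys UNIV \<Longrightarrow> \<phi> (\<psi> p) = p"
  shows "dhom \<psi>"
proof -
  note \<phi> = dhom_add[OF assms(1), symmetric] dhom_mult[OF assms(1), symmetric]
    dhom_dderiv[OF assms(1), symmetric]
  have *: "\<psi> p = p'" if "p = \<phi> p'" "p' \<in> polys UNIV" for p p'
    using that inv(1) by simp
  have "\<psi> (p + p') = \<psi> p + \<psi> p'" "\<psi> (p * p') = \<psi> p * \<psi> p'"
    if "p \<in> polys UNIV" "p' \<in> polys UNIV" for p p'
  proof -
    have "\<psi> p \<in> polys UNIV" "\<psi> p' \<in> polys UNIV" using that \<psi> by auto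
    then show "\<psi> (p + p') = \<psi> p + \<psi> p'" "\<psi> (p * p') = \<psi> p * \<psi> p'"
      using that by (intro *; simp add: dhom_add[OF assms(1)] dhom_mult[OF assms(1)] inv polys_add polys_mult)+
  qed
  moreover have "\<psi> (dderiv D d p) = dderiv D d (\<psi> p)" if "d \<in> \<Delta>" "p \<in> polys UNIV" for d p
  proof -
    have "\<psi> p \<in> polys UNIV" using that \<psi> by auto
    then show ?thesis
      using that by (intro *) (simp_all add: dhom_dderiv[OF assms(1)] inv polys_dderiv)
  qed
  moreover have "\<psi> (Const c) = Const c" for c
    by (intro *) (simp_all add: dhom_Const[OF assms(1)] polys_Const)
  ultimately show ?thesis using \<psi> by (simp add: dhom_def)
qed

lemma subgroup_auts: "subgroup (auts \<Delta> D) (BijGroup (polys UNIV))"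
proof -
  interpret B: group "BijGroup (polys UNIV)" by (rule group_BijGroup)
  have carrier: "carrier (BijGroup (polys UNIV)) = Bij (polys UNIV)"
    by (simp add: BijGroup_def)
  show ?thesis
  proof (rule B.subgroupI)
    show "auts \<Delta> D \<subseteq> carrier (BijGroup (polys UNIV))"
      by (auto simp: auts_eq carrier)
    have "(\<lambda>p\<in>polys UNIV. p) \<in> auts \<Delta> D"
      by (auto simp: auts_eq id_Bij intro: dhom_cong[OF dhom_id])
    then show "auts \<Delta> D \<noteq> {}" by blast
  next
    fix \<phi> assume "\<phi> \<in> auts \<Delta> D"
    then have \<phi>: "\<phi> \<in> Bij (polys UNIV)" "dhom \<phi>" by (auto simp: auts_eq)
    let ?\<psi> = "inv\<^bsub>BijGroup (polys UNIV)\<^esub> \<phi>"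
    have \<psi>: "?\<psi> \<in> Bij (polys UNIV)" using B.inv_closed \<phi> by (simp add: carrier)
    have one: "\<one>\<^bsub>BijGroup (polys UNIV)\<^esub> p = p" if "p \<in> polys UNIV" for p
      using that by (simp add: BijGroup_def)
    have inv: "?\<psi> (\<phi> p) = p" "\<phi> (?\<psi> p) = p" if "p \<in> polys UNIV" for p
      using BijGroup_apply[OF \<psi> \<phi>(1) that] BijGroup_apply[OF \<phi>(1) \<psi> that] one[OF that]
        B.l_inv[of \<phi>] B.r_inv[of \<phi>] \<phi>(1) by (simp_all add: carrier)
    show "?\<psi> \<in> auts \<Delta> D"
      using \<psi> dhom_inverse[OF \<phi>(2) Bij_imp_funcset[OF \<psi>] inv] by (simp add: auts_eq)
  next
    fix \<phi> \<psi> assume "\<phi> \<in> auts \<Delta> D" "\<psi> \<in> auts \<Delta> D"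
    then have *: "\<phi> \<in> Bij (polys UNIV)" "dhom \<phi>" "\<psi> \<in> Bij (polys UNIV)" "dhom \<psi>"
      by (auto simp: auts_eq)
    then have "\<phi> \<otimes>\<^bsub>BijGroup (polys UNIV)\<^esub> \<psi> \<in> Bij (polys UNIV)"
      using B.m_closed[of \<phi> \<psi>] by (simp add: carrier)
    with * show "\<phi> \<otimes>\<^bsub>BijGroup (polys UNIV)\<^esub> \<psi> \<in> auts \<Delta> D"
      by (auto simp: auts_eq BijGroup_apply intro: dhom_cong[OF dhom_comp])
  qed
qed

lemma group_Aut: "group (Aut \<Delta> D)"
  unfolding Aut_def dpolys_eq by (rule subgroup.subgroup_is_group[OF subgroup_auts group_BijGroup])

lemma carrier_Aut: "carrier (Aut \<Delta> D) = auts \<Delta> D"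
  by (simp add: Aut_def)

lemma Aut_one_apply: "p \<in> polys UNIV \<Longrightarrow> \<one>\<^bsub>Aut \<Delta> D\<^esub> p = p"
  by (simp add: Aut_def BijGroup_def dpolys_eq)

lemma Aut_mult_apply:
  "\<phi> \<in> auts \<Delta> D \<Longrightarrow> \<psi> \<in> auts \<Delta> D \<Longrightarrow> p \<in> polys UNIV \<Longrightarrow> (\<phi> \<otimes>\<^bsub>Aut \<Delta> D\<^esub> \<psi>) p = \<phi> (\<psi> p)"
  by (simp add: Aut_def dpolys_eq auts_eq BijGroup_apply)

interpretation A: group "Aut \<Delta> D"
  rewrites "carrier (Aut \<Delta> D) = auts \<Delta> D"
  by (rule group_Aut) (rule carrier_Aut)

lemma Aut_inv_apply:
  assumes "\<phi> \<in> auts \<Delta> D" "p \<in> polys UNIV" "\<phi> p = p'"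
  shows "(inv\<^bsub>Aut \<Delta> D\<^esub> \<phi>) p' = p"
  using Aut_mult_apply[of "inv\<^bsub>Aut \<Delta> D\<^esub> \<phi>" \<phi> p] assms A.inv_closed Aut_one_apply[of p]
    A.l_inv[of \<phi>] by simp

lemma vx_polys [simp]: "vx \<in> polys UNIV" and vy_polys [simp]: "vy \<in> polys UNIV"
  by (simp_all add: polys_vx polys_vy)

lemma Af2_iff:
  "\<phi> \<in> Af2 \<Delta> D \<longleftrightarrow> \<phi> \<in> auts \<Delta> D \<and> (\<exists>a1 b1 c1 a2 b2 c2. a1 * b2 \<noteq> a2 * b1 \<and>
     \<phi> vx = affine a1 b1 c1 \<and> \<phi> vy = affine a2 b2 c2)"
  by (simp add: Af2_def affine_def)

lemma Af2_I:
  "\<phi> \<in> auts \<Delta> D \<Longrightarrow> a1 * b2 \<noteq> a2 * b1 \<Longrightarrow> \<phi> vx = affine a1 b1 c1 \<Longrightarrow> \<phi> vy = affine a2 b2 c2 \<Longrightarrow>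
     \<phi> \<in> Af2 \<Delta> D"
  unfolding Af2_iff by blast

lemma Tr2_iff:
  "\<phi> \<in> Tr2 \<Delta> D \<longleftrightarrow> \<phi> \<in> auts \<Delta> D \<and> (\<exists>a b c f. a \<noteq> 0 \<and> b \<noteq> 0 \<and> f \<in> polys {GY} \<and>
     \<phi> vx = Const a * vx + f \<and> \<phi> vy = Const b * vy + Const c)"
  by (simp add: Tr2_def dpolys1_eq)

lemma Tr2_I:
  "\<phi> \<in> auts \<Delta> D \<Longrightarrow> a \<noteq> 0 \<Longrightarrow> b \<noteq> 0 \<Longrightarrow> f \<in> polys {GY} \<Longrightarrow> \<phi> vx = Const a * vx + f \<Longrightarrow>
     \<phi> vy = Const b * vy + Const c \<Longrightarrow> \<phi> \<in> Tr2 \<Delta> D"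
  unfolding Tr2_iff by blast

lemma affine_triangular: "affine 0 b c = Const b * vy + Const c"
  by (simp add: affine_def Const_0)

lemma polys_GY: "Const b * vy + Const c \<in> polys {GY}"
  by (simp add: polys_add polys_mult polys_Const polys_vy)

lemma polys_GX: "Const b * vx + Const c \<in> polys {GX}"
  by (simp add: polys_add polys_mult polys_Const polys_vx)

lemma subgroup_Af2: "subgroup (Af2 \<Delta> D) (Aut \<Delta> D)"
proof (rule A.subgroupI)
  show "Af2 \<Delta> D \<subseteq> auts \<Delta> D" by (auto simp: Af2_iff)
  have "\<one>\<^bsub>Aut \<Delta> D\<^esub> \<in> Af2 \<Delta> D"
    using A.one_closed by (intro Af2_I[of _ 1 1 0 0 0 0]) (auto simp: Aut_one_apply affine_vars affine_polys)
  then show "Af2 \<Delta> D \<noteq> {}" by blast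
next
  fix \<phi> assume "\<phi> \<in> Af2 \<Delta> D"
  then obtain a1 b1 c1 a2 b2 c2 where \<phi>: "\<phi> \<in> auts \<Delta> D" and det: "a1 * b2 \<noteq> a2 * b1"
    and v: "\<phi> vx = affine a1 b1 c1" "\<phi> vy = affine a2 b2 c2"
    unfolding Af2_iff by blast
  define e where "e = a1 * b2 - a2 * b1"
  have e: "e \<noteq> 0" using det by (simp add: e_def)
  have "\<phi> (affine (b2 / e) (- b1 / e) ((b1 * c2 - b2 * c1) / e)) = affine 1 0 0"
    unfolding dhom_affine[OF autsD[OF \<phi>]] v affine_combination
    by (rule affine_cong; (use e in \<open>simp add: field_simps\<close>); (simp add: e_def algebra_simps)?)
  moreover have "\<phi> (affine (- a2 / e) (a1 / e) ((a2 * c1 - a1 * c2) / e)) = affine 0 1 0"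
    unfolding dhom_affine[OF autsD[OF \<phi>]] v affine_combination
    by (rule affine_cong; (use e in \<open>simp add: field_simps\<close>); (simp add: e_def algebra_simps)?)
  moreover have "b2 / e * (a1 / e) \<noteq> - a2 / e * (- b1 / e)"
    using e by (simp add: field_simps) (simp add: e_def)
  ultimately show "inv\<^bsub>Aut \<Delta> D\<^esub> \<phi> \<in> Af2 \<Delta> D"
    using \<phi> by (intro Af2_I A.inv_closed Aut_inv_apply affine_polys) (auto simp: affine_vars)
next
  fix \<phi> \<psi> assume "\<phi> \<in> Af2 \<Delta> D" "\<psi> \<in> Af2 \<Delta> D"
  then obtain a1 b1 c1 a2 b2 c2 a1' b1' c1' a2' b2' c2'
    where \<phi>: "\<phi> \<in> auts \<Delta> D" "\<phi> vx = affine a1 b1 c1" "\<phi> vy = affine a2 b2 c2"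
      and \<psi>: "\<psi> \<in> auts \<Delta> D" "\<psi> vx = affine a1' b1' c1'" "\<psi> vy = affine a2' b2' c2'"
      and det: "a1 * b2 \<noteq> a2 * b1" "a1' * b2' \<noteq> a2' * b1'"
    unfolding Af2_iff by blast
  have "(a1 * b2 - a2 * b1) * (a1' * b2' - a2' * b1') \<noteq> 0" using det by simp
  then have "(a1' * a1 + b1' * a2) * (a2' * b1 + b2' * b2) \<noteq> (a2' * a1 + b2' * a2) * (a1' * b1 + b1' * b2)"
    by (simp add: algebra_simps)
  then show "\<phi> \<otimes>\<^bsub>Aut \<Delta> D\<^esub> \<psi> \<in> Af2 \<Delta> D"
    using \<phi> \<psi> by (intro Af2_I A.m_closed)
      (auto simp: Aut_mult_apply dhom_affine[OF autsD] affine_combination)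
qed

lemma subgroup_Tr2: "subgroup (Tr2 \<Delta> D) (Aut \<Delta> D)"
proof (rule A.subgroupI)
  show "Tr2 \<Delta> D \<subseteq> auts \<Delta> D" by (auto simp: Tr2_iff)
  have "\<one>\<^bsub>Aut \<Delta> D\<^esub> \<in> Tr2 \<Delta> D"
    using A.one_closed polys_Const[of 0]
    by (intro Tr2_I[of _ 1 1 0 0]) (auto simp: Aut_one_apply Const_0 Const_1)
  then show "Tr2 \<Delta> D \<noteq> {}" by blast
next
  fix \<phi> assume "\<phi> \<in> Tr2 \<Delta> D"
  then obtain a b c f where \<phi>: "\<phi> \<in> auts \<Delta> D" "a \<noteq> 0" "b \<noteq> 0" "f \<in> polys {GY}"
    and v: "\<phi> vx = Const a * vx + f" "\<phi> vy = Const b * vy + Const c"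
    unfolding Tr2_iff by blast
  let ?\<psi> = "inv\<^bsub>Aut \<Delta> D\<^esub> \<phi>"
  have \<psi>: "dhom ?\<psi>" using \<phi> by (intro autsD A.inv_closed)
  have "\<phi> (affine 0 (1 / b) (- c / b)) = affine 0 1 0"
    unfolding dhom_affine[OF autsD[OF \<phi>(1)]] v affine_triangular[symmetric]
    using \<phi>(3) by (simp add: Const_0 affine_triangular Const_1 Const_uminus algebra_simps Const_mult[symmetric])
  from Aut_inv_apply[OF \<phi>(1) affine_polys this]
  have \<psi>y: "?\<psi> vy = Const (1 / b) * vy + Const (- c / b)"
    unfolding affine_vars(2) unfolding affine_triangular .
  have f: "f \<in> polys UNIV" using \<phi>(4) polys_mono[of "{GY}" UNIV] by blast
  \<comment> \<open>The inverse is applied to \<open>\<phi> vx = a x + f\<close>, and the result is solved for its value at \<open>x\<close>.\<close>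
  have "vx = ?\<psi> (\<phi> vx)" using \<phi>(1) by (intro Aut_inv_apply[symmetric]) auto
  also have "\<dots> = Const a * ?\<psi> vx + ?\<psi> f"
    using f by (simp add: v dhom_add[OF \<psi>] dhom_mult[OF \<psi>] dhom_Const[OF \<psi>] polys_Const polys_mult)
  finally have "vx = Const a * ?\<psi> vx + ?\<psi> f" .
  from arg_cong[OF this, of "\<lambda>p. Const (1 / a) * p"]
  have "Const (1 / a) * vx = Const (1 / a * a) * ?\<psi> vx + Const (1 / a) * ?\<psi> f"
    by (simp only: Const_mult algebra_simps)
  then have \<psi>x: "?\<psi> vx = Const (1 / a) * vx + Const (- 1 / a) * ?\<psi> f"
    using \<phi>(2) by (simp add: Const_1 Const_uminus[of "1 / a", simplified])
  have "?\<psi> f \<in> polys {GY}"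
    using \<phi>(4) by (rule dhom_polys[OF \<psi>]) (use \<psi>y polys_GY in \<open>auto simp: vy_def\<close>)
  then have "Const (- 1 / a) * ?\<psi> f \<in> polys {GY}" by (intro polys_mult polys_Const)
  then show "?\<psi> \<in> Tr2 \<Delta> D"
    using \<phi> \<psi>x \<psi>y by (intro Tr2_I[of _ "1 / a" "1 / b"]) auto
next
  fix \<phi> \<psi> assume "\<phi> \<in> Tr2 \<Delta> D" "\<psi> \<in> Tr2 \<Delta> D"
  then obtain a b c f a' b' c' f'
    where \<phi>: "\<phi> \<in> auts \<Delta> D" "a \<noteq> 0" "b \<noteq> 0" "f \<in> polys {GY}"
      "\<phi> vx = Const a * vx + f" "\<phi> vy = Const b * vy + Const c"
    and \<psi>: "\<psi> \<in> auts \<Delta> D" "a' \<noteq> 0" "b' \<noteq> 0" "f' \<in> polys {GY}"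
      "\<psi> vx = Const a' * vx + f'" "\<psi> vy = Const b' * vy + Const c'"
    unfolding Tr2_iff by blast
  note h = autsD[OF \<phi>(1)]
  have f': "f' \<in> polys UNIV" using \<psi>(4) polys_mono[of "{GY}" UNIV] by blast
  have "\<phi> f' \<in> polys {GY}"
    using \<psi>(4) by (rule dhom_polys[OF h]) (use \<phi>(6) polys_GY in \<open>auto simp: vy_def\<close>)
  then have *: "Const a' * f + \<phi> f' \<in> polys {GY}" using \<phi>(4) by (intro polys_add polys_mult polys_Const)
  show "\<phi> \<otimes>\<^bsub>Aut \<Delta> D\<^esub> \<psi> \<in> Tr2 \<Delta> D"
  proof (rule Tr2_I[OF _ _ _ *])
    show "\<phi> \<otimes>\<^bsub>Aut \<Delta> D\<^esub> \<psi> \<in> auts \<Delta> D" using \<phi>(1) \<psi>(1) by simp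
    show "a' * a \<noteq> 0" "b' * b \<noteq> 0" using \<phi> \<psi> by auto
    show "(\<phi> \<otimes>\<^bsub>Aut \<Delta> D\<^esub> \<psi>) vx = Const (a' * a) * vx + (Const a' * f + \<phi> f')"
      using \<phi> \<psi> f' by (simp add: Aut_mult_apply dhom_add[OF h] dhom_mult[OF h] dhom_Const[OF h]
          polys_Const polys_mult Const_mult algebra_simps)
    show "(\<phi> \<otimes>\<^bsub>Aut \<Delta> D\<^esub> \<psi>) vy = Const (b' * b) * vy + Const (b' * c + c')"
      using \<phi> \<psi> by (simp add: Aut_mult_apply dhom_add[OF h] dhom_mult[OF h] dhom_Const[OF h]
          polys_Const polys_mult Const_mult Const_add algebra_simps)
  qed
qed

lemma elementaryI1:
  "\<phi> \<in> auts \<Delta> D \<Longrightarrow> a \<noteq> 0 \<Longrightarrow> f \<in> polys {GY} \<Longrightarrow> \<phi> vx = Const a * vx + f \<Longrightarrow> \<phi> vy = vy \<Longrightarrow>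
     \<phi> \<in> elementary \<Delta> D"
  unfolding elementary_def dpolys1_eq by blast

lemma elementaryI2:
  "\<phi> \<in> auts \<Delta> D \<Longrightarrow> a \<noteq> 0 \<Longrightarrow> g \<in> polys {GX} \<Longrightarrow> \<phi> vx = vx \<Longrightarrow> \<phi> vy = Const a * vy + g \<Longrightarrow>
     \<phi> \<in> elementary \<Delta> D"
  unfolding elementary_def dpolys1_eq by blast

lemma elementary_auts: "elementary \<Delta> D \<subseteq> auts \<Delta> D"
  by (auto simp: elementary_def)

abbreviation tame where "tame \<equiv> generate (Aut \<Delta> D) (elementary \<Delta> D)"

lemma subgroup_tame: "subgroup tame (Aut \<Delta> D)"
  using elementary_auts by (rule A.generate_is_subgroup)

text \<open>
  The form in which tameness is proved below: column operations, that is, right multiplications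
  by elementary automorphisms, may be used to simplify the given automorphism.
\<close>

lemma tame_cancel:
  assumes "\<phi> \<in> auts \<Delta> D" "\<beta> \<in> elementary \<Delta> D" "\<phi> \<otimes>\<^bsub>Aut \<Delta> D\<^esub> \<beta> \<in> tame"
  shows "\<phi> \<in> tame"
proof -
  have \<beta>: "\<beta> \<in> auts \<Delta> D" using assms(2) elementary_auts by blast
  have "\<phi> = (\<phi> \<otimes>\<^bsub>Aut \<Delta> D\<^esub> \<beta>) \<otimes>\<^bsub>Aut \<Delta> D\<^esub> inv\<^bsub>Aut \<Delta> D\<^esub> \<beta>"
    using assms(1) \<beta> by (simp add: A.m_assoc)
  then show ?thesis
    using assms by (metis generate.eng generate.inv)
qed

text \<open>
  An elementary automorphism acting on \<open>y\<close> alone undoes \<open>y \<mapsto> b y + c\<close>, and what remains is elementary.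
\<close>

lemma Tr2_tame: "Tr2 \<Delta> D \<subseteq> tame"
proof
  fix \<phi> assume "\<phi> \<in> Tr2 \<Delta> D"
  then obtain a b c f where \<phi>: "\<phi> \<in> auts \<Delta> D" "a \<noteq> 0" "b \<noteq> 0" "f \<in> polys {GY}"
    "\<phi> vx = Const a * vx + f" "\<phi> vy = Const b * vy + Const c"
    unfolding Tr2_iff by blast
  obtain \<beta> where \<beta>: "\<beta> \<in> auts \<Delta> D" "\<beta> vx = affine 1 0 0" "\<beta> vy = affine 0 (1 / b) (- c / b)"
    using affine_aut_exists[of 1 "1 / b" 0 0] \<phi>(3) by auto
  have \<beta>_el: "\<beta> \<in> elementary \<Delta> D"
    using \<beta> \<phi>(3) polys_Const
    by (intro elementaryI2[of _ "1 / b" "Const (- c / b)"]) (auto simp: affine_vars affine_triangular)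
  have "\<phi> (affine 0 (1 / b) (- c / b)) = vy"
    unfolding dhom_affine[OF autsD[OF \<phi>(1)]] \<phi>(5,6)
    using \<phi>(3) by (simp add: Const_0 distrib_left mult.assoc[symmetric] Const_mult[symmetric] Const_1 Const_uminus)
  then have "(\<phi> \<otimes>\<^bsub>Aut \<Delta> D\<^esub> \<beta>) vy = vy"
    by (simp only: Aut_mult_apply[OF \<phi>(1) \<beta>(1) vy_polys] \<beta>(3))
  moreover have "(\<phi> \<otimes>\<^bsub>Aut \<Delta> D\<^esub> \<beta>) vx = Const a * vx + f"
    by (simp only: Aut_mult_apply[OF \<phi>(1) \<beta>(1) vx_polys] \<beta>(2) affine_vars \<phi>(5))
  ultimately have "\<phi> \<otimes>\<^bsub>Aut \<Delta> D\<^esub> \<beta> \<in> elementary \<Delta> D"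
    by (intro elementaryI1[of _ a f] A.m_closed \<phi> \<beta>)
  then show "\<phi> \<in> tame" by (rule tame_cancel[OF \<phi>(1) \<beta>_el generate.incl])
qed

text \<open>
  Gaussian elimination: if \<open>x\<close> occurs in the image of \<open>x\<close>, a multiple of that image is added to the image
  of \<open>y\<close> so that the automorphism becomes triangular. Otherwise the image of \<open>y\<close> is first added to that
  of \<open>x\<close>.
\<close>

lemma Af2_tame: "Af2 \<Delta> D \<subseteq> tame"
proof -
  have 1: "\<phi> \<in> tame" if \<phi>: "\<phi> \<in> auts \<Delta> D" "\<phi> vx = affine a1 b1 c1" "\<phi> vy = affine a2 b2 c2"
    and det: "a1 * b2 \<noteq> a2 * b1" and a1: "a1 \<noteq> 0" for \<phi> a1 b1 c1 a2 b2 c2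
  proof -
    obtain \<beta> where \<beta>: "\<beta> \<in> auts \<Delta> D" "\<beta> vx = affine 1 0 0" "\<beta> vy = affine (- a2 / a1) 1 0"
      using affine_aut_exists[of 1 1 "- a2 / a1" 0] by auto
    have "\<beta> \<in> elementary \<Delta> D"
      using \<beta> polys_GX[of "- a2 / a1" 0]
      by (intro elementaryI2[of _ 1 "Const (- a2 / a1) * vx"]) (auto simp: affine_def Const_0 Const_1)
    moreover have "\<phi> (affine (- a2 / a1) 1 0) = affine 0 (b2 - a2 * b1 / a1) (c2 - a2 * c1 / a1)"
      unfolding dhom_affine[OF autsD[OF \<phi>(1)]] \<phi>(2,3) affine_combination
      by (rule affine_cong; use a1 in \<open>simp add: field_simps\<close>)
    then have "\<phi> \<otimes>\<^bsub>Aut \<Delta> D\<^esub> \<beta> \<in> Tr2 \<Delta> D"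
      using \<phi> \<beta> a1 det polys_GY[of b1 c1]
      by (intro Tr2_I[of _ a1 "b2 - a2 * b1 / a1" "Const b1 * vy + Const c1" "c2 - a2 * c1 / a1"])
        (auto simp: Aut_mult_apply affine_vars(1) affine_triangular field_simps,
         auto simp: affine_def add.assoc)
    ultimately show ?thesis using \<phi>(1) Tr2_tame tame_cancel by blast
  qed
  show ?thesis
  proof
    fix \<phi> assume "\<phi> \<in> Af2 \<Delta> D"
    then obtain a1 b1 c1 a2 b2 c2 where \<phi>: "\<phi> \<in> auts \<Delta> D" "\<phi> vx = affine a1 b1 c1" "\<phi> vy = affine a2 b2 c2"
      and det: "a1 * b2 \<noteq> a2 * b1"
      unfolding Af2_iff by blast
    show "\<phi> \<in> tame"
    proof (cases "a1 = 0")
      case False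
      with 1 \<phi> det show ?thesis by blast
    next
      case True
      obtain \<beta> where \<beta>: "\<beta> \<in> auts \<Delta> D" "\<beta> vx = affine 1 1 0" "\<beta> vy = affine 0 1 0"
        using affine_aut_exists[of 1 1 0 1] by auto
      have "\<beta> \<in> elementary \<Delta> D"
        using \<beta> polys_GY[of 1 0]
        by (intro elementaryI1[of _ 1 vy]) (auto simp: affine_def Const_0 Const_1)
      moreover have "\<phi> (affine 1 1 0) = affine a2 (b1 + b2) (c1 + c2)" "\<phi> (affine 0 1 0) = affine a2 b2 c2"
        unfolding dhom_affine[OF autsD[OF \<phi>(1)]] \<phi>(2,3) affine_combination using True by simp_all
      then have "\<phi> \<otimes>\<^bsub>Aut \<Delta> D\<^esub> \<beta> \<in> tame"
        using \<phi> \<beta> det True by (intro 1[of _ a2 "b1 + b2" "c1 + c2" a2 b2 c2])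
          (auto simp: Aut_mult_apply algebra_simps)
      ultimately show ?thesis using \<phi>(1) tame_cancel by blast
    qed
  qed
qed

text \<open>
  Only \<open>(x, a y + g(x))\<close> needs an argument: the exchange of \<open>x\<close> and \<open>y\<close> is affine and conjugates it to
  \<open>(a x + g(y), y)\<close>.
\<close>

lemma elementary_generated: "elementary \<Delta> D \<subseteq> generate (Aut \<Delta> D) (Af2 \<Delta> D \<union> Tr2 \<Delta> D)"
proof
  fix \<phi> assume "\<phi> \<in> elementary \<Delta> D"
  then consider a f where "\<phi> \<in> auts \<Delta> D" "a \<noteq> 0" "f \<in> polys {GY}" "\<phi> vx = Const a * vx + f" "\<phi> vy = vy"
    | a g where "\<phi> \<in> auts \<Delta> D" "a \<noteq> 0" "g \<in> polys {GX}" "\<phi> vx = vx" "\<phi> vy = Const a * vy + g"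
    unfolding elementary_def dpolys1_eq by blast
  then show "\<phi> \<in> generate (Aut \<Delta> D) (Af2 \<Delta> D \<union> Tr2 \<Delta> D)"
  proof cases
    case 1
    then have "\<phi> \<in> Tr2 \<Delta> D" by (intro Tr2_I[of _ a 1 f 0]) (auto simp: Const_0 Const_1)
    then show ?thesis by (intro generate.incl) simp
  next
    case 2
    obtain s where s: "s \<in> auts \<Delta> D" "s vx = affine 0 1 0" "s vy = affine 1 0 0"
      using affine_aut_exists[of 0 0 1 1] by auto
    have sA: "s \<in> Af2 \<Delta> D" using s by (intro Af2_I[of _ 0 0 1 1]) auto
    have sv: "s vx = vy" "s vy = vx" using s by (simp_all add: affine_vars)
    let ?t = "s \<otimes>\<^bsub>Aut \<Delta> D\<^esub> \<phi> \<otimes>\<^bsub>Aut \<Delta> D\<^esub> s"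
    note h = autsD[OF s(1)]
    have g: "g \<in> polys UNIV" using 2(3) polys_mono[of "{GX}" UNIV] by blast
    have "s g \<in> polys {GY}"
      using 2(3) by (rule dhom_polys[OF h]) (use sv polys_vy in \<open>auto simp: vx_def\<close>)
    then have "?t \<in> Tr2 \<Delta> D"
      using 2 s(1) g by (intro Tr2_I[of _ a 1 "s g" 0])
        (auto simp: Aut_mult_apply sv dhom_add[OF h] dhom_mult[OF h] dhom_Const[OF h] polys_Const
          polys_mult Const_0 Const_1)
    moreover have "\<phi> = inv\<^bsub>Aut \<Delta> D\<^esub> s \<otimes>\<^bsub>Aut \<Delta> D\<^esub> ?t \<otimes>\<^bsub>Aut \<Delta> D\<^esub> inv\<^bsub>Aut \<Delta> D\<^esub> s"
      using 2(1) s(1) by (simp add: A.m_assoc A.inv_solve_left)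
    ultimately show ?thesis
      using sA by (metis UnI1 UnI2 generate.eng generate.incl generate.inv)
  qed
qed

lemma group_Tame: "group (Tame \<Delta> D)"
  unfolding Tame_def by (rule subgroup.subgroup_is_group[OF subgroup_tame group_Aut])

lemma subgroups_Tame: "subgroup (Af2 \<Delta> D) (Tame \<Delta> D)" "subgroup (Tr2 \<Delta> D) (Tame \<Delta> D)"
  unfolding Tame_def
  by (intro A.subgroup_incl subgroup_Af2 subgroup_Tr2 subgroup_tame Af2_tame Tr2_tame)+

lemma Tame_generated: "carrier (Tame \<Delta> D) \<subseteq> generate (Tame \<Delta> D) (Af2 \<Delta> D \<union> Tr2 \<Delta> D)"
proof -
  have "generate (Tame \<Delta> D) (Af2 \<Delta> D \<union> Tr2 \<Delta> D) = generate (Aut \<Delta> D) (Af2 \<Delta> D \<union> Tr2 \<Delta> D)"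
    unfolding Tame_def using Af2_tame Tr2_tame subgroup_tame
    by (intro A.generate_consistent) auto
  moreover have "subgroup (generate (Aut \<Delta> D) (Af2 \<Delta> D \<union> Tr2 \<Delta> D)) (Aut \<Delta> D)"
    by (intro A.generate_is_subgroup) (auto simp: Af2_iff Tr2_iff)
  then have "tame \<subseteq> generate (Aut \<Delta> D) (Af2 \<Delta> D \<union> Tr2 \<Delta> D)"
    using elementary_generated by (intro A.generate_subgroup_incl)
  ultimately show ?thesis by (simp add: Tame_def)
qed

end

section \<open>Leading monomials\<close>

text \<open>
  A ranking of the variables by natural numbers under which each derivation acts as multiplication by a
  fixed factor at least two; it then increases all ranks and preserves strict inequalities between
  them. Placing \<open>x\<close> below \<open>y\<close> makes the identity automorphism a
  valid starting point for a word that begins with a triangular letter (\<open>ydom_one\<close>).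
\<close>

locale ranked = diff_field \<Delta> D for \<Delta> :: "'d set" and D :: "'d \<Rightarrow> 'k::field_char_0 \<Rightarrow> 'k" +
  fixes rank :: "'d dvar \<Rightarrow> nat" and q :: "'d \<Rightarrow> nat"
  assumes rank_shift: "d \<in> \<Delta> \<Longrightarrow> rank (dshift d v) = q d * rank v"
    and q_ge: "d \<in> \<Delta> \<Longrightarrow> q d \<ge> 2"
    and rank_pos: "rank v > 0"
    and rank_inj: "inj_on rank (UNIV \<times> Theta \<Delta>)"
    and rank_xy: "rank (GX, 0) < rank (GY, 0)"

text \<open>
  Distinct odd primes are assigned to the derivation symbols, so that \<open>\<theta>\<close> becomes an odd number from
  which it can be recovered by unique factorization. A factor two distinguishes the derivatives of
  \<open>y\<close> from those of \<open>x\<close>.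
\<close>

lemma (in diff_field) ranking_exists: "\<exists>rank q. ranked \<Delta> D rank q"
proof -
  have "infinite {p::nat. prime p \<and> p > 2}"
  proof
    assume "finite {p::nat. prime p \<and> p > 2}"
    then have "finite ({p::nat. prime p \<and> p > 2} \<union> {..2})" by simp
    moreover have "{p::nat. prime p} \<subseteq> {p. prime p \<and> p > 2} \<union> {..2}" by auto
    ultimately show False using primes_infinite finite_subset by blast
  qed
  from infinite_countable_subset[OF this]
  obtain g :: "nat \<Rightarrow> nat" where g: "inj g" "range g \<subseteq> {p. prime p \<and> p > 2}" by auto
  obtain h :: "'d \<Rightarrow> nat" where h: "inj_on h \<Delta>"
    using finite_imp_inj_to_nat_seg[OF fin] by blast
  define q where "q d = g (h d)" for d
  have q_prime: "prime (q d)" and q_gt: "q d > 2" for d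
    using g(2) by (auto simp: q_def)
  have q_inj: "inj_on q \<Delta>"
    using g(1) h by (auto simp: q_def inj_on_def)
  define N where "N \<theta> = (\<Prod>d\<in>\<Delta>. q d ^ Poly_Mapping.lookup \<theta> d)" for \<theta>
  define rank where "rank v = (case fst v of GX \<Rightarrow> 1 | GY \<Rightarrow> 2) * N (snd v)" for v :: "'d dvar"
  have N_shift: "N (\<theta> + Poly_Mapping.single d 1) = q d * N \<theta>" if "d \<in> \<Delta>" for \<theta> d
  proof -
    have "(\<Prod>e\<in>\<Delta>. q e ^ Poly_Mapping.lookup (Poly_Mapping.single d (1::nat)) e) =
        (\<Prod>e\<in>\<Delta>. if e = d then q d else 1)"
      by (intro prod.cong) (auto simp: lookup_single when_def)
    also have "\<dots> = q d" using that fin by simp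
    finally show ?thesis
      by (simp add: N_def lookup_add power_add prod.distrib mult.commute)
  qed
  have N_pos: "N \<theta> > 0" for \<theta>
    unfolding N_def by (intro prod_pos zero_less_power ballI prime_gt_0_nat q_prime)
  have N_odd: "odd (N \<theta>)" for \<theta>
  proof
    assume "even (N \<theta>)"
    then obtain d where "2 dvd q d ^ Poly_Mapping.lookup \<theta> d"
      unfolding N_def using prime_dvd_prod_iff[OF fin, of "2::nat"] by auto
    then have "2 dvd q d" using prime_dvd_power[of "2::nat"] by auto
    with q_prime[of d] q_gt[of d] show False
      using prime_odd_nat by blast
  qed
  have N_mult: "multiplicity (q d) (N \<theta>) = Poly_Mapping.lookup \<theta> d" if "d \<in> \<Delta>" for \<theta> d
  proof -
    have "N \<theta> = (\<Prod>p\<in>q ` \<Delta>. p ^ Poly_Mapping.lookup \<theta> (inv_into \<Delta> q p))"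
      unfolding N_def using q_inj by (simp add: prod.reindex)
    also have "multiplicity (q d) \<dots> = Poly_Mapping.lookup \<theta> (inv_into \<Delta> q (q d))"
      using that fin q_prime
      by (subst multiplicity_prod_prime_powers) auto
    finally show ?thesis using that q_inj by simp
  qed
  have "ranked \<Delta> D rank q"
  proof (unfold_locales)
    show "rank (dshift d v) = q d * rank v" if "d \<in> \<Delta>" for d v
      using N_shift[OF that] by (simp add: rank_def dshift_def)
    show "q d \<ge> 2" for d using q_gt[of d] by simp
    show "rank v > 0" for v using N_pos by (auto simp: rank_def split: gen.split)
    show "rank (GX, 0) < rank (GY, 0)" using N_pos by (simp add: rank_def)
    show "inj_on rank (UNIV \<times> Theta \<Delta>)"
    proof (rule inj_onI, clarify)
      fix z \<theta> z' \<theta>' assume \<theta>: "\<theta> \<in> Theta \<Delta>" "\<theta>' \<in> Theta \<Delta>" and eq: "rank (z, \<theta>) = rank (z', \<theta>')"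
      have "even (rank (z, \<theta>)) = (z = GY)" "even (rank (z', \<theta>')) = (z' = GY)"
        using N_odd by (auto simp: rank_def split: gen.split)
      with eq have z: "z = z'" by (cases z; cases z') auto
      with eq have "N \<theta> = N \<theta>'" by (auto simp: rank_def split: gen.splits)
      have "Poly_Mapping.lookup \<theta> d = Poly_Mapping.lookup \<theta>' d" for d
      proof (cases "d \<in> \<Delta>")
        case True
        then show ?thesis using N_mult[of d \<theta>] N_mult[of d \<theta>'] \<open>N \<theta> = N \<theta>'\<close> by simp
      next
        case False
        then have "d \<notin> Poly_Mapping.keys \<theta>" "d \<notin> Poly_Mapping.keys \<theta>'"
          using \<theta> by (auto simp: Theta_def)
        then show ?thesis by (simp add: in_keys_iff)
      qed
      then show "z = z' \<and> \<theta> = \<theta>'" using z by (auto intro: poly_mapping_eqI)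
    qed
  qed
  then show ?thesis by blast
qed

text \<open>
  In the application, \<open>B\<close> is \<open>m/u\<close> and \<open>add_mset (r v) B\<close> is \<open>(m/u) u\<^sup>\<theta>\<close>, with \<open>v0\<close> the case \<open>\<theta> = 1\<close>. All
  \<open>r v\<close> with \<open>v \<noteq> v0\<close> lie above \<open>B\<close>, so their multiplicities in the sum are the exponents themselves.
  The multiplicity of \<open>r v0\<close> is then a known number plus \<open>1 + count B (r v0)\<close> times the exponent at
  \<open>v0\<close>, which determines that exponent as well.
\<close>

lemma shifted_multisets_inj:
  fixes e e' :: "'v \<Rightarrow>\<^sub>0 nat" and r :: "'v \<Rightarrow> 'a::linorder"
  assumes r: "inj_on r V" and v0: "v0 \<in> V" and gt: "\<And>v. v \<in> V \<Longrightarrow> v \<noteq> v0 \<Longrightarrow> r v > r v0"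
    and B: "\<And>x. x \<in># B \<Longrightarrow> x \<le> r v0"
    and e: "Poly_Mapping.keys e \<subseteq> V" and e': "Poly_Mapping.keys e' \<subseteq> V"
    and eq: "(\<Sum>v\<in>Poly_Mapping.keys e. repeat_mset (Poly_Mapping.lookup e v) (add_mset (r v) B)) =
             (\<Sum>v\<in>Poly_Mapping.keys e'. repeat_mset (Poly_Mapping.lookup e' v) (add_mset (r v) B))"
  shows "e = e'"
proof -
  define S where "S = Poly_Mapping.keys e \<union> Poly_Mapping.keys e' \<union> {v0}"
  have S: "finite S" "S \<subseteq> V" using e e' v0 by (auto simp: S_def)
  have cnt: "count (\<Sum>v\<in>Poly_Mapping.keys g. repeat_mset (Poly_Mapping.lookup g v) (add_mset (r v) B)) (r w) =
      Poly_Mapping.lookup g w + (\<Sum>v\<in>S. Poly_Mapping.lookup g v) * count B (r w)"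
    if "Poly_Mapping.keys g \<subseteq> S" "w \<in> S" for g w
  proof -
    have "count (\<Sum>v\<in>Poly_Mapping.keys g. repeat_mset (Poly_Mapping.lookup g v) (add_mset (r v) B)) (r w) =
        (\<Sum>v\<in>Poly_Mapping.keys g. Poly_Mapping.lookup g v * count (add_mset (r v) B) (r w))"
      by (auto simp: count_sum intro!: sum.cong)
    also have "\<dots> = (\<Sum>v\<in>S. Poly_Mapping.lookup g v * count (add_mset (r v) B) (r w))"
      using that S by (intro sum.mono_neutral_left) (auto simp: in_keys_iff)
    also have "\<dots> = (\<Sum>v\<in>S. (if v = w then Poly_Mapping.lookup g v else 0) +
        Poly_Mapping.lookup g v * count B (r w))"
    proof (rule sum.cong[OF HOL.refl])
      fix v assume "v \<in> S"
      then have "r v = r w \<longleftrightarrow> v = w" using that S r inj_on_eq_iff by (metis subsetD)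
      then show "Poly_Mapping.lookup g v * count (add_mset (r v) B) (r w) =
          (if v = w then Poly_Mapping.lookup g v else 0) + Poly_Mapping.lookup g v * count B (r w)"
        by simp
    qed
    also have "\<dots> = Poly_Mapping.lookup g w + (\<Sum>v\<in>S. Poly_Mapping.lookup g v) * count B (r w)"
      using that S by (simp add: sum.distrib sum_distrib_right)
    finally show ?thesis .
  qed
  have eqs: "Poly_Mapping.lookup e w + (\<Sum>v\<in>S. Poly_Mapping.lookup e v) * count B (r w) =
      Poly_Mapping.lookup e' w + (\<Sum>v\<in>S. Poly_Mapping.lookup e' v) * count B (r w)" if "w \<in> S" for w
  proof -
    have "Poly_Mapping.keys e \<subseteq> S" "Poly_Mapping.keys e' \<subseteq> S" by (auto simp: S_def)
    then show ?thesis
      using that by (simp only: cnt[symmetric] eq)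
  qed
  have other: "Poly_Mapping.lookup e w = Poly_Mapping.lookup e' w" if "w \<in> S" "w \<noteq> v0" for w
  proof -
    have "count B (r w) = 0"
      using gt[of w] B[of "r w"] that S by (auto simp: count_eq_zero_iff)
    with eqs[OF that(1)] show ?thesis by simp
  qed
  have "v0 \<in> S" by (simp add: S_def)
  moreover define s where "s = (\<Sum>v\<in>S - {v0}. Poly_Mapping.lookup e v)"
  moreover have "s = (\<Sum>v\<in>S - {v0}. Poly_Mapping.lookup e' v)"
    unfolding s_def using other by (intro sum.cong) auto
  ultimately have "Poly_Mapping.lookup e v0 + (Poly_Mapping.lookup e v0 + s) * count B (r v0) =
      Poly_Mapping.lookup e' v0 + (Poly_Mapping.lookup e' v0 + s) * count B (r v0)"
    using eqs[of v0] S by (simp add: sum.remove)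
  then have "Poly_Mapping.lookup e v0 * (1 + count B (r v0)) = Poly_Mapping.lookup e' v0 * (1 + count B (r v0))"
    by (simp add: algebra_simps)
  then have "Poly_Mapping.lookup e v0 = Poly_Mapping.lookup e' v0"
    by (subst (asm) mult_right_cancel) simp_all
  with other have "Poly_Mapping.lookup e w = Poly_Mapping.lookup e' w" for w
    by (cases "w \<in> S") (auto simp: S_def in_keys_iff)
  then show ?thesis by (rule poly_mapping_eqI)
qed

context ranked
begin

text \<open>
  The order of multisets over a linear order compares multiplicities of the largest elements first.
  Comparing monomials through \<open>mu\<close> is therefore the lexicographic order with the variable of highest
  rank first; it is compatible with products by \<open>mu_add\<close>.
\<close>

definition mu :: "('d dvar \<Rightarrow>\<^sub>0 nat) \<Rightarrow> nat multiset" where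
  "mu m = (\<Sum>v\<in>Poly_Mapping.keys m. replicate_mset (Poly_Mapping.lookup m v) (rank v))"

lemma mu_superset:
  "finite S \<Longrightarrow> Poly_Mapping.keys m \<subseteq> S \<Longrightarrow>
     mu m = (\<Sum>v\<in>S. replicate_mset (Poly_Mapping.lookup m v) (rank v))"
  unfolding mu_def by (intro sum.mono_neutral_left) (auto simp: in_keys_iff)

lemma mu_add: "mu (m + n) = mu m + mu n"
proof -
  let ?S = "Poly_Mapping.keys m \<union> Poly_Mapping.keys n"
  have "replicate_mset (i + j) x = replicate_mset i x + replicate_mset j x" for i j and x :: nat
    by (rule multiset_eqI) simp
  then show ?thesis
    using mu_superset[of ?S "m + n"] mu_superset[of ?S m] mu_superset[of ?S n] Poly_Mapping.keys_add[of m n]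
    by (simp add: lookup_add sum.distrib)
qed

lemma mu_0: "mu 0 = {#}"
  by (simp add: mu_def)

lemma mu_var: "mu (Poly_Mapping.single v 1) = {#rank v#}"
  by (simp add: mu_def)

lemma set_mu: "set_mset (mu m) = rank ` Poly_Mapping.keys m"
  by (auto simp: mu_def set_mset_sum in_keys_iff split: if_splits)

lemma monomial_remove:
  "v \<in> Poly_Mapping.keys m \<Longrightarrow> m = m - Poly_Mapping.single v 1 + Poly_Mapping.single v (1::nat)"
  by (rule poly_mapping_eqI)
    (auto simp: lookup_add lookup_minus lookup_single when_def in_keys_iff)

lemma mu_remove:
  assumes "v \<in> Poly_Mapping.keys m"
  shows "mu m = add_mset (rank v) (mu (m - Poly_Mapping.single v 1))"
  using arg_cong[OF monomial_remove[OF assms], of mu] by (simp add: mu_add mu_var[simplified])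

definition below :: "('d, 'k) dpoly \<Rightarrow> nat multiset \<Rightarrow> bool" where
  "below p M \<longleftrightarrow> (\<forall>n\<in>Poly_Mapping.keys p. mu n < M)"

text \<open>
  The leading monomial itself is needed to differentiate, since the effect of a derivation depends on
  its variable of highest rank. For products, sums and comparisons its multiset of ranks is enough,
  which is what \<open>LT\<close> records.
\<close>

definition lead :: "('d, 'k) dpoly \<Rightarrow> ('d dvar \<Rightarrow>\<^sub>0 nat) \<Rightarrow> bool" where
  "lead p m \<longleftrightarrow> (\<exists>c p'. c \<noteq> 0 \<and> p = Poly_Mapping.single m c + p' \<and> below p' (mu m))"

definition LT :: "('d, 'k) dpoly \<Rightarrow> nat multiset \<Rightarrow> bool" where
  "LT p M \<longleftrightarrow> (\<exists>m. lead p m \<and> mu m = M)"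

lemma below_add: "below p M \<Longrightarrow> below p' M \<Longrightarrow> below (p + p') M"
  using Poly_Mapping.keys_add[of p p'] by (auto simp: below_def)

lemma below_sum: "(\<And>i. i \<in> I \<Longrightarrow> below (f i) M) \<Longrightarrow> below (\<Sum>i\<in>I. f i) M"
  by (induction I rule: infinite_finite_induct) (auto intro: below_add, auto simp: below_def)

lemma below_single: "mu m < M \<Longrightarrow> below (Poly_Mapping.single m c) M"
  by (auto simp: below_def)

lemma below_mono: "below p M \<Longrightarrow> M \<le> N \<Longrightarrow> below p N"
  by (auto simp: below_def)

lemma below_mult:
  assumes "\<And>m n. m \<in> Poly_Mapping.keys p \<Longrightarrow> n \<in> Poly_Mapping.keys p' \<Longrightarrow> mu m + mu n < M"
  shows "below (p * p') M"
  using Poly_Mapping.keys_mult[of p p'] assms by (fastforce simp: below_def mu_add)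

lemma LT_E:
  assumes "LT p M"
  obtains m c p' where "c \<noteq> 0" "p = Poly_Mapping.single m c + p'" "below p' M" "mu m = M"
  using assms by (auto simp: LT_def lead_def)

lemma LT_I: "c \<noteq> 0 \<Longrightarrow> p = Poly_Mapping.single m c + p' \<Longrightarrow> below p' M \<Longrightarrow> mu m = M \<Longrightarrow> LT p M"
  by (auto simp: LT_def lead_def)

lemma LT_below: "LT p M \<Longrightarrow> M < N \<Longrightarrow> below p N"
  by (elim LT_E) (auto intro!: below_add below_single intro: below_mono)

lemma LT_add: "LT p M \<Longrightarrow> below p' M \<Longrightarrow> LT (p + p') M"
  by (elim LT_E) (auto intro!: LT_I below_add simp: add.assoc)

lemma LT_Const: "c \<noteq> 0 \<Longrightarrow> LT (Const c) {#}"
  by (rule LT_I[of c _ 0 0]) (auto simp: Const_def below_def mu_0)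

lemma LT_Var: "LT (Var v) {#rank v#}"
  by (rule LT_I[of 1 _ "Poly_Mapping.single v 1" 0]) (auto simp: Var_def below_def mu_var[simplified])

lemma LT_mult:
  assumes "LT p M" "LT p' N"
  shows "LT (p * p') (M + N)"
proof -
  obtain m c r where p: "c \<noteq> 0" "p = Poly_Mapping.single m c + r" "below r M" "mu m = M"
    using assms(1) by (rule LT_E)
  obtain n d s where p': "d \<noteq> 0" "p' = Poly_Mapping.single n d + s" "below s N" "mu n = N"
    using assms(2) by (rule LT_E)
  have "p * p' = Poly_Mapping.single (m + n) (c * d) +
      (Poly_Mapping.single m c * s + r * Poly_Mapping.single n d + r * s)"
    unfolding p(2) p'(2) by (simp add: algebra_simps mult_single)
  moreover have "below (Poly_Mapping.single m c * s + r * Poly_Mapping.single n d + r * s) (M + N)"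
    using p p' by (intro below_add below_mult)
      (auto simp: below_def intro: add_strict_mono)
  ultimately show ?thesis
    using p p' by (intro LT_I) (auto simp: mu_add)
qed

lemma LT_power: "LT p M \<Longrightarrow> LT (p ^ n) (repeat_mset n M)"
  using LT_Const[of 1] by (induction n) (auto simp: Const_1 intro: LT_mult)

lemma LT_prod:
  "(\<And>i. i \<in> I \<Longrightarrow> LT (f i) (M i)) \<Longrightarrow> LT (\<Prod>i\<in>I. f i) (\<Sum>i\<in>I. M i)"
  using LT_Const[of 1]
  by (induction I rule: infinite_finite_induct) (auto simp: Const_1 intro: LT_mult)

lemma LT_scale: "LT p M \<Longrightarrow> c \<noteq> 0 \<Longrightarrow> LT (Const c * p) M"
  using LT_mult[OF LT_Const, of c p M] by simp

text \<open>
  Terms with distinct leading monomials cannot cancel at the top.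
\<close>

lemma LT_sum:
  assumes "finite I" "I \<noteq> {}" "\<And>i. i \<in> I \<Longrightarrow> LT (f i) (M i)" "inj_on M I"
  shows "LT (\<Sum>i\<in>I. f i) (Max (M ` I))"
proof -
  have "Max (M ` I) \<in> M ` I" using assms by (intro Max_in) auto
  then obtain i where i: "i \<in> I" "Max (M ` I) = M i" by auto
  have "M j < M i" if "j \<in> I - {i}" for j
    using assms that i Max_ge[of "M ` I" "M j"] by (auto simp: inj_on_def order_less_le)
  then have "below (\<Sum>j\<in>I - {i}. f j) (M i)"
    using assms by (intro below_sum) (auto intro: LT_below)
  then show ?thesis
    using LT_add[OF assms(3)[OF i(1)]] assms(1) i by (simp add: sum.remove)
qed

lemma LT_nonzero_key: "LT p M \<Longrightarrow> \<exists>m\<in>Poly_Mapping.keys p. mu m = M"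
  by (elim LT_E) (auto simp: below_def in_keys_iff lookup_add lookup_single intro!: bexI)

lemma lead_key: "lead p m \<Longrightarrow> m \<in> Poly_Mapping.keys p"
  by (auto simp: lead_def below_def in_keys_iff lookup_add)

definition leading_var :: "('d dvar \<Rightarrow>\<^sub>0 nat) \<Rightarrow> 'd dvar \<Rightarrow> bool" where
  "leading_var m u \<longleftrightarrow> u \<in> Poly_Mapping.keys m \<and> (\<forall>w\<in>Poly_Mapping.keys m. w \<noteq> u \<longrightarrow> rank w < rank u)"

lemma leading_var_exists:
  assumes "Poly_Mapping.keys m \<subseteq> UNIV \<times> Theta \<Delta>" "m \<noteq> 0"
  shows "\<exists>u. leading_var m u"
proof -
  have "Max (rank ` Poly_Mapping.keys m) \<in> rank ` Poly_Mapping.keys m"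
    using assms(2) by (intro Max_in) auto
  then obtain u where u: "u \<in> Poly_Mapping.keys m" "rank u = Max (rank ` Poly_Mapping.keys m)"
    by (metis imageE)
  then have "rank w \<le> rank u" if "w \<in> Poly_Mapping.keys m" for w
    using that by simp
  moreover have "rank w \<noteq> rank u" if "w \<in> Poly_Mapping.keys m" "w \<noteq> u" for w
    using inj_onD[OF inj_on_subset[OF rank_inj assms(1)], of w u] that u(1) by blast
  ultimately have "leading_var m u"
    using u(1) by (auto simp: leading_var_def order_less_le)
  then show ?thesis by blast
qed

lemma rank_less_shift: "d \<in> \<Delta> \<Longrightarrow> rank v < rank (dshift d v)"
  using rank_pos[of v] q_ge[of d] by (simp add: rank_shift)

lemma multiset_le_bound:
  assumes "M \<le> N" "\<And>y. y \<in># N \<Longrightarrow> y \<le> (b::nat)" "x \<in># M"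
  shows "x \<le> b"
proof (rule ccontr)
  assume "\<not> x \<le> b"
  then have "N < M" using assms by (intro ex_gt_imp_less_multiset) force
  with assms(1) show False by simp
qed

text \<open>
  Differentiating \<open>c m\<close> gives \<open>c\<close> times the exponent of \<open>u\<close> times \<open>(m/u) u\<^sup>\<delta>\<close>, plus terms below.
  Differentiating a coefficient keeps a monomial of variables of rank at most that of \<open>u\<close>, which lies below
  because \<open>u\<^sup>\<delta>\<close> does not occur in it; replacing \<open>v\<close> by \<open>v\<^sup>\<delta>\<close> for \<open>v\<close> of smaller rank than \<open>u\<close> stays below
  for the same reason; and in a monomial \<open>n < m\<close> with \<open>u\<close> as highest variable, \<open>n/u < m/u\<close>.
  The exponent of \<open>u\<close> is not zero in \<open>k\<close> because the characteristic is zero.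
\<close>

lemma lead_dderiv:
  assumes p: "lead p m" and u: "leading_var m u" and d: "d \<in> \<Delta>"
  shows "lead (dderiv D d p) (m - Poly_Mapping.single u 1 + Poly_Mapping.single (dshift d u) 1)"
proof -
  let ?S = "\<lambda>n v. n - Poly_Mapping.single v 1 + Poly_Mapping.single (dshift d v) (1::nat)"
  obtain c p' where c: "c \<noteq> 0" and p_eq: "p = Poly_Mapping.single m c + p'" and p': "below p' (mu m)"
    using p by (auto simp: lead_def)
  have uk: "u \<in> Poly_Mapping.keys m" using u by (simp add: leading_var_def)
  have mu_S: "mu (?S n v) = add_mset (rank (dshift d v)) (mu (n - Poly_Mapping.single v 1))" for n v
    by (simp add: mu_add mu_var[simplified])
  have bound: "x \<le> rank u" if "mu n \<le> mu m" "x \<in># mu n" for n x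
  proof (rule multiset_le_bound[OF that(1) _ that(2)])
    show "y \<le> rank u" if "y \<in># mu m" for y
      using that u by (force simp: set_mu leading_var_def)
  qed
  have sub: "x \<in># mu n" if "x \<in># mu (n - Poly_Mapping.single v 1)" "v \<in> Poly_Mapping.keys n" for x n v
    using that mu_remove[of v n] by simp
  have shift_lt: "rank (dshift d v) < rank (dshift d u)" if "rank v < rank u" for v
    using that d q_ge[of d] by (simp add: rank_shift)
  have n1: "mu n < mu (?S m u)" if "mu n \<le> mu m" for n
    using bound[OF that] rank_less_shift[OF d, of u]
    unfolding mu_S by (intro ex_gt_imp_less_multiset) force
  have n2: "mu (?S n v) < mu (?S m u)"
    if n: "mu n \<le> mu m" and v: "v \<in> Poly_Mapping.keys n" and ne: "mu n < mu m \<or> rank v < rank u" for n v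
  proof (cases "rank v < rank u")
    case True
    have "x < rank (dshift d u)" if "x \<in># mu (?S n v)" for x
    proof -
      from that consider "x = rank (dshift d v)" | "x \<in># mu (n - Poly_Mapping.single v 1)"
        unfolding mu_S by auto
      then show ?thesis
      proof cases
        case 1
        then show ?thesis using shift_lt[OF True] by simp
      next
        case 2
        then show ?thesis
          using bound[OF n sub[OF 2 v]] rank_less_shift[OF d, of u] by simp
      qed
    qed
    then show ?thesis
      unfolding mu_S[of m] by (intro ex_gt_imp_less_multiset) auto
  next
    case False
    moreover have "rank v \<in># mu n" using v by (simp add: set_mu)
    ultimately have eq: "rank v = rank u" using bound[OF n] by force
    have "add_mset (rank u) (mu (n - Poly_Mapping.single v 1)) <
        add_mset (rank u) (mu (m - Poly_Mapping.single u 1))"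
      using ne False mu_remove[OF v] mu_remove[OF uk] eq by simp
    then have "mu (n - Poly_Mapping.single v 1) < mu (m - Poly_Mapping.single u 1)"
      by simp
    then show ?thesis
      unfolding mu_S using eq d by (simp add: rank_shift)
  qed
  let ?t = "\<lambda>n a v. Poly_Mapping.single (?S n v) (of_nat (Poly_Mapping.lookup n v) * a)"
  have "below (dderiv D d p') (mu (?S m u))"
    unfolding dderiv_def dterm_def
    by (intro below_sum below_add below_single n1 n2)
      (use p' in \<open>auto simp: below_def\<close>)
  moreover have "below (Poly_Mapping.single m (D d c)) (mu (?S m u))"
    by (intro below_single n1) simp
  moreover have "below (\<Sum>v\<in>Poly_Mapping.keys m - {u}. ?t m c v) (mu (?S m u))"
    by (intro below_sum below_single n2) (use u in \<open>auto simp: leading_var_def\<close>)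
  moreover have "dderiv D d p = ?t m c u + (Poly_Mapping.single m (D d c) +
      (\<Sum>v\<in>Poly_Mapping.keys m - {u}. ?t m c v) + dderiv D d p')"
    unfolding p_eq dd_add[OF d] dderiv_single[where D = D and d = d, OF D_0[OF d]] dterm_def
    using uk by (simp add: sum.remove[of _ u] algebra_simps)
  moreover have "of_nat (Poly_Mapping.lookup m u) * c \<noteq> 0"
    using c uk by (simp add: in_keys_iff)
  ultimately show ?thesis
    unfolding lead_def by (blast intro: below_add)
qed

definition dmult :: "'d dvar \<Rightarrow> ('d \<Rightarrow>\<^sub>0 nat) \<Rightarrow> 'd dvar" where
  "dmult u \<theta> = (fst u, snd u + \<theta>)"

lemma rank_dmult: "\<theta> \<in> Theta \<Delta> \<Longrightarrow> \<theta> \<noteq> 0 \<Longrightarrow> rank u < rank (dmult u \<theta>)"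
proof (induction \<theta> rule: Theta_induct)
  case (shift \<theta> d)
  have "dmult u (\<theta> + Poly_Mapping.single d 1) = dshift d (dmult u \<theta>)"
    by (simp add: dmult_def dshift_def add.assoc)
  moreover have "rank u \<le> rank (dmult u \<theta>)"
    using shift by (cases "\<theta> = 0") (auto simp: dmult_def)
  ultimately show ?case using rank_less_shift[OF shift(2), of "dmult u \<theta>"] by simp
qed simp

text \<open>
  Iteration of \<open>lead_dderiv\<close>. The new leading monomial has \<open>u\<^sup>\<theta>\<close> as its variable of highest rank, so each
  further derivation acts on this factor only, and \<open>m/u\<close> is not touched again.
\<close>

lemma lead_dhom_Var:
  assumes \<phi>: "dhom \<phi>" and m: "lead (\<phi> (Var (z, 0))) m" and u: "leading_var m u" and "\<theta> \<in> Theta \<Delta>"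
  shows "lead (\<phi> (Var (z, \<theta>))) (m - Poly_Mapping.single u 1 + Poly_Mapping.single (dmult u \<theta>) 1)"
    and "leading_var (m - Poly_Mapping.single u 1 + Poly_Mapping.single (dmult u \<theta>) 1) (dmult u \<theta>)"
  using \<open>\<theta> \<in> Theta \<Delta>\<close>
proof (induction \<theta> rule: Theta_induct)
  case zero
  have "m - Poly_Mapping.single u 1 + Poly_Mapping.single (dmult u 0) 1 = m"
    using monomial_remove[of u m] u by (simp add: dmult_def leading_var_def)
  with m u show "lead (\<phi> (Var (z, 0))) (m - Poly_Mapping.single u 1 + Poly_Mapping.single (dmult u 0) 1)"
    "leading_var (m - Poly_Mapping.single u 1 + Poly_Mapping.single (dmult u 0) 1) (dmult u 0)"
    by (simp_all add: dmult_def)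
next
  case (shift \<theta> d)
  let ?\<eta> = "\<theta> + Poly_Mapping.single d 1"
  let ?m = "m - Poly_Mapping.single u 1"
  have \<eta>: "dmult u ?\<eta> = dshift d (dmult u \<theta>)"
    by (simp add: dmult_def dshift_def add.assoc)
  have "\<phi> (Var (z, ?\<eta>)) = dderiv D d (\<phi> (Var (z, \<theta>)))"
    using dhom_dderiv[OF \<phi> shift(2), of "Var (z, \<theta>)"] shift(1,2)
    by (simp add: dd_Var polys_Var dshift_def)
  with lead_dderiv[OF shift(3,4,2)]
  show "lead (\<phi> (Var (z, ?\<eta>))) (?m + Poly_Mapping.single (dmult u ?\<eta>) 1)"
    by (simp only: \<eta> add_diff_cancel_right')
  have "rank w < rank (dmult u ?\<eta>)"
    if "w \<in> Poly_Mapping.keys (?m + Poly_Mapping.single (dmult u ?\<eta>) 1)" "w \<noteq> dmult u ?\<eta>" for w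
  proof -
    have "w \<in> Poly_Mapping.keys ?m" using that by (auto simp: in_keys_iff lookup_add lookup_single when_def)
    then have "w \<in> Poly_Mapping.keys m" by (simp add: in_keys_iff lookup_minus)
    with u have "rank w \<le> rank u" by (force simp: leading_var_def)
    moreover have "?\<eta> \<noteq> 0"
    proof
      assume "?\<eta> = 0"
      then have "Poly_Mapping.lookup ?\<eta> d = 0" by simp
      then show False by (simp add: lookup_add)
    qed
    then have "rank u < rank (dmult u ?\<eta>)"
      using rank_dmult[OF Theta_shift] shift(1,2) by blast
    ultimately show ?thesis by simp
  qed
  then show "leading_var (?m + Poly_Mapping.single (dmult u ?\<eta>) 1) (dmult u ?\<eta>)"
    by (auto simp: leading_var_def in_keys_iff lookup_add)
qed

text \<open>
  The heart of the argument. The monomials \<open>e\<close> of \<open>f\<close> are sent to elements with leading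
  multisets \<open>T e\<close>, which are pairwise distinct by \<open>shifted_multisets_inj\<close>. Hence the leading
  monomial of the image of \<open>f\<close> is the largest \<open>T e\<close>. The monomial \<open>y\<close> contributes \<open>M\<close>; a monomial
  containing a proper derivative of \<open>y\<close> contributes more because \<open>u\<^sup>\<theta>\<close> ranks above \<open>u\<close>, and a higher power of
  \<open>y\<close> contributes a proper multiple of \<open>M\<close>.
\<close>

lemma LT_dhom_nonlinear:
  assumes \<phi>: "dhom \<phi>" and M: "LT (\<phi> vy) M" "M \<noteq> {#}" and f: "f \<in> polys {GY}"
    and nonlinear: "\<And>b c. f \<noteq> Const b * vy + Const c"
  shows "\<exists>N. LT (\<phi> f) N \<and> M < N"
proof -
  obtain m where m: "lead (\<phi> vy) m" "mu m = M" using M(1) by (auto simp: LT_def)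
  have "\<phi> vy \<in> polys UNIV" using dhom_closed[OF \<phi>] by (simp add: polys_vy)
  then have "Poly_Mapping.keys m \<subseteq> UNIV \<times> Theta \<Delta>"
    using lead_key[OF m(1)] by (auto simp: polys_def vars_def)
  moreover have "m \<noteq> 0" using m(2) M(2) mu_0 by auto
  ultimately obtain u where u: "leading_var m u" using leading_var_exists by blast
  define B where "B = mu (m - Poly_Mapping.single u 1)"
  have M_eq: "M = add_mset (rank u) B"
    using mu_remove[of u m] u m(2) by (simp add: leading_var_def B_def)
  have B_le: "x \<le> rank u" if "x \<in># B" for x
  proof -
    have "x \<in># mu m" using that m(2) M_eq by simp
    with u show ?thesis by (force simp: set_mu leading_var_def)
  qed
  define V where "V = {GY} \<times> Theta \<Delta>"
  define r where "r v = rank (dmult u (snd v))" for v :: "'d dvar"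
  have uT: "snd u \<in> Theta \<Delta>"
    using \<open>Poly_Mapping.keys m \<subseteq> UNIV \<times> Theta \<Delta>\<close> u by (auto simp: leading_var_def)
  have r_inj: "inj_on r V"
  proof (rule inj_onI)
    fix v w assume vw: "v \<in> V" "w \<in> V" "r v = r w"
    have "dmult u (snd x) \<in> UNIV \<times> Theta \<Delta>" if "x \<in> V" for x
    proof -
      have "Poly_Mapping.keys (snd u + snd x) \<subseteq> \<Delta>"
        using that uT by (intro order.trans[OF Poly_Mapping.keys_add] Un_least) (auto simp: V_def Theta_def)
      then show ?thesis by (simp add: dmult_def Theta_def)
    qed
    with vw rank_inj have "dmult u (snd v) = dmult u (snd w)"
      unfolding r_def by (blast dest: inj_onD)
    with vw show "v = w" by (auto simp: V_def dmult_def)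
  qed
  have r0: "r (GY, 0) = rank u" by (simp add: r_def dmult_def)
  have r_gt: "r v > r (GY, 0)" if "v \<in> V" "v \<noteq> (GY, 0)" for v
    using that rank_dmult[of "snd v" u] r0 by (cases "snd v = 0") (auto simp: V_def r_def)
  have LT_Var: "LT (\<phi> (Var v)) (add_mset (r v) B)" if "v \<in> V" for v
    using lead_dhom_Var(1)[OF \<phi> _ u, of GY "snd v"] m that
    by (auto simp: LT_def V_def vy_def mu_add mu_var[simplified] B_def r_def)
  define T where "T e = (\<Sum>v\<in>Poly_Mapping.keys e. repeat_mset (Poly_Mapping.lookup e v) (add_mset (r v) B))"
    for e :: "'d dvar \<Rightarrow>\<^sub>0 nat"
  have keys_f: "Poly_Mapping.keys e \<subseteq> V" if "e \<in> Poly_Mapping.keys f" for e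
    using f that by (auto simp: polys_def vars_def V_def)
  have V_polys: "Var v \<in> polys UNIV" if "v \<in> V" for v
    using that by (auto simp: polys_Var V_def)
  have single_eq: "Poly_Mapping.single e c \<in> polys UNIV \<and>
      \<phi> (Poly_Mapping.single e c) = Const c * (\<Prod>v\<in>Poly_Mapping.keys e. \<phi> (Var v) ^ Poly_Mapping.lookup e v)"
    if "e \<in> Poly_Mapping.keys f" for e c
  proof -
    have pow: "Var v ^ k \<in> polys UNIV" "\<phi> (Var v ^ k) = \<phi> (Var v) ^ k"
      if "v \<in> Poly_Mapping.keys e" for v k
      by (intro polys_power dhom_power[OF \<phi>] V_polys subsetD[OF keys_f[OF \<open>e \<in> Poly_Mapping.keys f\<close>] that])+
    have prod: "(\<Prod>v\<in>Poly_Mapping.keys e. Var v ^ Poly_Mapping.lookup e v) \<in> polys UNIV"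
      by (intro polys_prod pow(1))
    have "\<phi> (\<Prod>v\<in>Poly_Mapping.keys e. Var v ^ Poly_Mapping.lookup e v) =
        (\<Prod>v\<in>Poly_Mapping.keys e. \<phi> (Var v ^ Poly_Mapping.lookup e v))"
      by (intro dhom_prod[OF \<phi>] pow(1))
    then show ?thesis
      unfolding single_eq_prod[of e c] dhom_mult[OF \<phi> polys_Const prod] dhom_Const[OF \<phi>]
      by (simp add: polys_mult polys_Const prod pow(2))
  qed
  have LT_single: "LT (\<phi> (Poly_Mapping.single e (Poly_Mapping.lookup f e))) (T e)"
    if "e \<in> Poly_Mapping.keys f" for e
    unfolding T_def conjunct2[OF single_eq[OF that]]
    by (intro LT_scale LT_prod LT_power LT_Var subsetD[OF keys_f[OF that]])
      (use that in \<open>auto simp: in_keys_iff\<close>)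
  have T_inj: "inj_on T (Poly_Mapping.keys f)"
    using shifted_multisets_inj[OF r_inj _ r_gt _ keys_f keys_f, of B] B_le r0
    by (intro inj_onI) (auto simp: T_def V_def Theta_0)
  obtain e where e: "e \<in> Poly_Mapping.keys f" "e \<noteq> 0" "e \<noteq> Poly_Mapping.single (GY, 0) 1"
  proof -
    have "f = Const (Poly_Mapping.lookup f (Poly_Mapping.single (GY, 0) 1)) * vy + Const (Poly_Mapping.lookup f 0)"
      if "Poly_Mapping.keys f \<subseteq> {0, Poly_Mapping.single (GY, 0) 1}"
    proof (rule poly_mapping_eqI)
      fix k
      have "Poly_Mapping.single (GY, 0) (1::nat) \<noteq> (0 :: 'd dvar \<Rightarrow>\<^sub>0 nat)"
        by (metis lookup_single_eq lookup_zero zero_neq_one)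
      then show "Poly_Mapping.lookup f k = Poly_Mapping.lookup (Const (Poly_Mapping.lookup f (Poly_Mapping.single (GY, 0) 1)) * vy + Const (Poly_Mapping.lookup f 0)) k"
        using that by (auto simp: Const_def vy_def Var_def mult_single lookup_add lookup_single when_def in_keys_iff)
    qed
    with nonlinear that show ?thesis by blast
  qed
  have "M < T e"
  proof (cases "Poly_Mapping.keys e \<subseteq> {(GY, 0)}")
    case True
    define n where "n = Poly_Mapping.lookup e (GY, 0)"
    have e_eq: "e = Poly_Mapping.single (GY, 0) n"
    proof (rule poly_mapping_eqI)
      fix v
      have "v = (GY, 0) \<or> v \<notin> Poly_Mapping.keys e" using True by blast
      then show "Poly_Mapping.lookup e v = Poly_Mapping.lookup (Poly_Mapping.single (GY, 0) n) v"
        by (auto simp: n_def lookup_single when_def in_keys_iff)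
    qed
    with e(2,3) have "n \<noteq> 0" "n \<noteq> 1" by (metis single_zero, metis)
    then obtain k where k: "n = Suc (Suc k)" by (metis One_nat_def not0_implies_Suc)
    then have "T e = M + (M + repeat_mset k M)"
      by (simp add: T_def e_eq r0 M_eq)
    with M(2) show ?thesis by (auto intro: le_multiset_plus_right_nonempty)
  next
    case False
    then obtain v where v: "v \<in> Poly_Mapping.keys e" "v \<noteq> (GY, 0)" by auto
    obtain k where k: "Poly_Mapping.lookup e v = Suc k"
      using v(1) by (metis in_keys_iff not0_implies_Suc)
    have "M < add_mset (r v) B"
      using r_gt[of v] v keys_f[OF e(1)] r0 by (auto simp: M_eq)
    also have "\<dots> \<le> T e"
      using v(1) k by (simp add: T_def sum.remove[of _ v])
    finally show ?thesis .
  qed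
  also have "T e \<le> Max (T ` Poly_Mapping.keys f)" using e(1) by simp
  finally have "M < Max (T ` Poly_Mapping.keys f)" .
  moreover have "\<phi> f = (\<Sum>e\<in>Poly_Mapping.keys f. \<phi> (Poly_Mapping.single e (Poly_Mapping.lookup f e)))"
    by (subst dpoly_eq_sum_single[of f], subst dhom_sum[OF \<phi>]) (use single_eq in auto)
  moreover have "Poly_Mapping.keys f \<noteq> {}" using e(1) by blast
  ultimately show ?thesis
    using LT_sum[OF finite_keys _ LT_single T_inj] by auto
qed

end

section \<open>Alternating words of automorphisms\<close>

context ranked
begin

definition atmost :: "('d, 'k) dpoly \<Rightarrow> nat multiset \<Rightarrow> bool" where
  "atmost p M \<longleftrightarrow> (\<forall>n\<in>Poly_Mapping.keys p. mu n \<le> M)"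

lemma atmost_add: "atmost p M \<Longrightarrow> atmost p' M \<Longrightarrow> atmost (p + p') M"
  using Poly_Mapping.keys_add[of p p'] by (auto simp: atmost_def)

lemma atmost_scale: "atmost p M \<Longrightarrow> atmost (Const c * p) M"
  using Poly_Mapping.keys_mult[of "Const c" p] by (fastforce simp: atmost_def Const_def split: if_splits)

lemma atmost_Const: "atmost (Const c) M"
  by (simp add: atmost_def Const_def mu_0)

lemma atmost_mono: "atmost p M \<Longrightarrow> M \<le> N \<Longrightarrow> atmost p N"
  by (auto simp: atmost_def)

lemma LT_atmost: "LT p M \<Longrightarrow> atmost p M"
  using Poly_Mapping.keys_add by (elim LT_E) (fastforce simp: atmost_def below_def split: if_splits)

lemma atmost_below: "atmost p M \<Longrightarrow> M < N \<Longrightarrow> below p N"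
  by (auto simp: atmost_def below_def)

lemma Const_below: "M \<noteq> {#} \<Longrightarrow> below (Const c) M"
  by (auto simp: below_def Const_def mu_0)

text \<open>
  The size of \<open>y\<close>, which bounds the images of \<open>x\<close> and \<open>y\<close> under affine automorphisms.
\<close>

definition mu_vy where "mu_vy = {#rank (GY, 0)#}"

text \<open>
  The two states through which a product of alternating letters passes: \<open>xdom\<close> after a triangular
  letter, \<open>ydom\<close> after an affine one. In \<open>ydom\<close> the inequality is weak and the image of \<open>x\<close> need not have a leading
  monomial below that of the image of \<open>y\<close>, since both may be combinations with the same leading part.
\<close>

definition xdom :: "(('d, 'k) dpoly \<Rightarrow> ('d, 'k) dpoly) \<Rightarrow> bool" where
  "xdom \<phi> \<longleftrightarrow> (\<exists>M N. LT (\<phi> vx) N \<and> LT (\<phi> vy) M \<and> mu_vy \<le> M \<and> M < N)"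

definition ydom :: "(('d, 'k) dpoly \<Rightarrow> ('d, 'k) dpoly) \<Rightarrow> bool" where
  "ydom \<phi> \<longleftrightarrow> (\<exists>M. LT (\<phi> vy) M \<and> mu_vy \<le> M \<and> atmost (\<phi> vx) M)"

text \<open>
  What distinguishes the product from every affine automorphism, in particular from the identity.
\<close>

definition big :: "(('d, 'k) dpoly \<Rightarrow> ('d, 'k) dpoly) \<Rightarrow> bool" where
  "big \<phi> \<longleftrightarrow> \<not> atmost (\<phi> vx) mu_vy \<or> \<not> atmost (\<phi> vy) mu_vy"

lemma LT_not_atmost: "LT p M \<Longrightarrow> mu_vy < M \<Longrightarrow> \<not> atmost p mu_vy"
  using LT_nonzero_key[of p M] unfolding atmost_def by (metis leD)

lemma affine_not_big:
  assumes "\<phi> \<in> Af2 \<Delta> D"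
  shows "\<not> big \<phi>"
proof -
  have "atmost vx mu_vy" "atmost vy mu_vy"
    using rank_xy LT_atmost[OF LT_Var, of "(GX, 0)"] LT_atmost[OF LT_Var, of "(GY, 0)"]
    by (auto simp: mu_vy_def vx_def vy_def intro: atmost_mono)
  then have "atmost (affine a b c) mu_vy" for a b c
    unfolding affine_def by (intro atmost_add atmost_scale atmost_Const)
  with assms show ?thesis by (auto simp: Af2_iff big_def)
qed

lemma ydom_one: "ydom \<one>\<^bsub>Aut \<Delta> D\<^esub>"
proof -
  have "atmost vx mu_vy"
    using rank_xy LT_atmost[OF LT_Var, of "(GX, 0)"]
    by (auto simp: mu_vy_def vx_def intro: atmost_mono)
  moreover have "LT vy mu_vy" using LT_Var[of "(GY, 0)"] by (simp add: mu_vy_def vy_def)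
  ultimately show ?thesis by (auto simp: ydom_def Aut_one_apply)
qed

text \<open>
  The nonlinear part \<open>f\<close> is substituted at the image of \<open>y\<close>, which dominates the image of \<open>x\<close>, so by
  \<open>LT_dhom_nonlinear\<close> the result dominates both.
\<close>

lemma triangular_step:
  assumes \<phi>: "\<phi> \<in> auts \<Delta> D" "ydom \<phi>" and \<tau>: "\<tau> \<in> Tr2 \<Delta> D" "\<tau> \<notin> Af2 \<Delta> D"
  shows "xdom (\<phi> \<otimes>\<^bsub>Aut \<Delta> D\<^esub> \<tau>) \<and> big (\<phi> \<otimes>\<^bsub>Aut \<Delta> D\<^esub> \<tau>)"
proof -
  obtain a b c f where f: "\<tau> \<in> auts \<Delta> D" "a \<noteq> 0" "b \<noteq> 0" "f \<in> polys {GY}"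
    "\<tau> vx = Const a * vx + f" "\<tau> vy = Const b * vy + Const c"
    using \<tau>(1) unfolding Tr2_iff by blast
  obtain M where M: "LT (\<phi> vy) M" "mu_vy \<le> M" "atmost (\<phi> vx) M"
    using \<phi>(2) by (auto simp: ydom_def)
  have M_ne: "M \<noteq> {#}" using M(2) by (auto simp: mu_vy_def)
  have nonlinear: "f \<noteq> Const b' * vy + Const c'" for b' c'
  proof
    assume "f = Const b' * vy + Const c'"
    then have "\<tau> vx = affine a b' c'" "\<tau> vy = affine 0 b c"
      using f by (simp_all add: affine_def Const_0 add.assoc)
    then have "\<tau> \<in> Af2 \<Delta> D" using f by (intro Af2_I[of _ a b 0 b' c' c]) auto
    with \<tau>(2) show False ..
  qed
  note h = autsD[OF \<phi>(1)]
  obtain N where N: "LT (\<phi> f) N" "M < N"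
    using LT_dhom_nonlinear[OF h M(1) M_ne f(4) nonlinear] by blast
  have fU: "f \<in> polys UNIV" using f(4) polys_mono[of "{GY}" UNIV] by blast
  have x: "(\<phi> \<otimes>\<^bsub>Aut \<Delta> D\<^esub> \<tau>) vx = \<phi> f + Const a * \<phi> vx"
    using \<phi> f fU by (simp add: Aut_mult_apply dhom_add[OF h] dhom_mult[OF h] dhom_Const[OF h]
        polys_Const polys_mult)
  have y: "(\<phi> \<otimes>\<^bsub>Aut \<Delta> D\<^esub> \<tau>) vy = Const b * \<phi> vy + Const c"
    using \<phi> f by (simp add: Aut_mult_apply dhom_add[OF h] dhom_mult[OF h] dhom_Const[OF h]
        polys_Const polys_mult)
  have "LT ((\<phi> \<otimes>\<^bsub>Aut \<Delta> D\<^esub> \<tau>) vx) N"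
    unfolding x using N M by (intro LT_add atmost_below[of _ M] atmost_scale)
  moreover have "LT ((\<phi> \<otimes>\<^bsub>Aut \<Delta> D\<^esub> \<tau>) vy) M"
    unfolding y using M M_ne f by (intro LT_add LT_scale Const_below)
  ultimately show ?thesis
    using N(2) M(2) LT_not_atmost[of _ N] by (auto simp: xdom_def big_def)
qed

text \<open>
  The coefficient of \<open>x\<close> in the second component of a non-triangular affine automorphism is not zero, so the
  dominating image of \<open>x\<close> is carried over to the image of \<open>y\<close>.
\<close>

lemma affine_step:
  assumes \<phi>: "\<phi> \<in> auts \<Delta> D" "xdom \<phi>" and \<alpha>: "\<alpha> \<in> Af2 \<Delta> D" "\<alpha> \<notin> Tr2 \<Delta> D"
  shows "ydom (\<phi> \<otimes>\<^bsub>Aut \<Delta> D\<^esub> \<alpha>) \<and> big (\<phi> \<otimes>\<^bsub>Aut \<Delta> D\<^esub> \<alpha>)"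
proof -
  obtain a1 b1 c1 a2 b2 c2 where a: "\<alpha> \<in> auts \<Delta> D" "a1 * b2 \<noteq> a2 * b1"
    "\<alpha> vx = affine a1 b1 c1" "\<alpha> vy = affine a2 b2 c2"
    using \<alpha>(1) unfolding Af2_iff by blast
  obtain M N where MN: "LT (\<phi> vx) N" "LT (\<phi> vy) M" "mu_vy \<le> M" "M < N"
    using \<phi>(2) by (auto simp: xdom_def)
  have N_ne: "N \<noteq> {#}" using MN(4) by auto
  have "a2 \<noteq> 0"
  proof
    assume "a2 = 0"
    then have "\<alpha> \<in> Tr2 \<Delta> D"
      using a polys_GY[of b1 c1] by (intro Tr2_I[of _ a1 b2 "Const b1 * vy + Const c1" c2])
        (auto simp: affine_def Const_0 add.assoc)
    with \<alpha>(2) show False ..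
  qed
  note h = autsD[OF \<phi>(1)]
  have x: "(\<phi> \<otimes>\<^bsub>Aut \<Delta> D\<^esub> \<alpha>) vx = Const a1 * \<phi> vx + Const b1 * \<phi> vy + Const c1"
    and y: "(\<phi> \<otimes>\<^bsub>Aut \<Delta> D\<^esub> \<alpha>) vy = Const a2 * \<phi> vx + Const b2 * \<phi> vy + Const c2"
    using \<phi> a by (simp_all add: Aut_mult_apply dhom_affine[OF h])
  have My: "atmost (\<phi> vy) N" using LT_atmost[OF MN(2)] MN(4) by (auto intro: atmost_mono)
  have "LT ((\<phi> \<otimes>\<^bsub>Aut \<Delta> D\<^esub> \<alpha>) vy) N"
    unfolding y using MN N_ne \<open>a2 \<noteq> 0\<close> LT_atmost[OF MN(2)]
    by (intro LT_add LT_scale Const_below atmost_below[of _ M] atmost_scale)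
  moreover have "atmost ((\<phi> \<otimes>\<^bsub>Aut \<Delta> D\<^esub> \<alpha>) vx) N"
    unfolding x using My LT_atmost[OF MN(1)] by (intro atmost_add atmost_scale atmost_Const)
  moreover have "mu_vy < N" using MN by simp
  ultimately show ?thesis
    using LT_not_atmost[of _ N] by (auto simp: ydom_def big_def)
qed

lemma alternating_big:
  assumes "\<phi> \<in> auts \<Delta> D" "w \<in> lists (Af2 \<Delta> D <+> Tr2 \<Delta> D)" "w \<noteq> []"
    "alternating (Af2 \<Delta> D \<inter> Tr2 \<Delta> D) w"
    "if isl (hd w) then xdom \<phi> else ydom \<phi>"
  shows "big (\<phi> \<otimes>\<^bsub>Aut \<Delta> D\<^esub> word_eval (Aut \<Delta> D) w)"
  using assms
proof (induction w arbitrary: \<phi>)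
  case (Cons l w)
  interpret A: group "Aut \<Delta> D" by (rule group_Aut)
  define g where "g = case_sum id id l"
  let ?\<psi> = "\<phi> \<otimes>\<^bsub>Aut \<Delta> D\<^esub> g"
  have auts: "case_sum id id l \<in> auts \<Delta> D" if "l \<in> Af2 \<Delta> D <+> Tr2 \<Delta> D" for l
    using that by (auto simp: Af2_iff Tr2_iff)
  have g: "g \<in> auts \<Delta> D" using Cons.prems(2) auts by (simp add: g_def)
  have ev: "word_eval (Aut \<Delta> D) w \<in> auts \<Delta> D" if "w \<in> lists (Af2 \<Delta> D <+> Tr2 \<Delta> D)" for w
    using A.word_eval_closed[OF that subgroup.subset[OF subgroup_Af2] subgroup.subset[OF subgroup_Tr2]]
    by (simp add: carrier_Aut)
  have \<psi>: "?\<psi> \<in> auts \<Delta> D" using A.m_closed Cons.prems(1) g by (simp add: carrier_Aut)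
  have step: "(if isl l then ydom ?\<psi> else xdom ?\<psi>) \<and> big ?\<psi>"
    using Cons.prems affine_step[OF Cons.prems(1)] triangular_step[OF Cons.prems(1)]
    by (cases l) (auto simp: alternating_Cons g_def)
  have "\<phi> \<otimes>\<^bsub>Aut \<Delta> D\<^esub> word_eval (Aut \<Delta> D) (l # w) = ?\<psi> \<otimes>\<^bsub>Aut \<Delta> D\<^esub> word_eval (Aut \<Delta> D) w"
    using Cons.prems g ev[of w] A.m_assoc[of \<phi> g] by (simp add: word_eval_def g_def carrier_Aut)
  moreover have "big (?\<psi> \<otimes>\<^bsub>Aut \<Delta> D\<^esub> word_eval (Aut \<Delta> D) w)"
  proof (cases "w = []")
    case True
    then show ?thesis using step \<psi> A.r_one by (simp add: word_eval_def carrier_Aut)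
  next
    case False
    then show ?thesis
      using step Cons.prems \<psi> by (intro Cons.IH) (auto simp: alternating_Cons split: if_splits)
  qed
  ultimately show ?case by simp
qed simp

text \<open>
  The chain of states starts at the identity and so applies to words that begin with a triangular
  letter; these are not even affine. A word of value one that begins with an affine letter would,
  after removal of this letter, be such a word with an affine value.
\<close>

lemma alternating_nontrivial:
  assumes w: "w \<in> lists (Af2 \<Delta> D <+> Tr2 \<Delta> D)" "w \<noteq> []"
    and alt: "alternating (Af2 \<Delta> D \<inter> Tr2 \<Delta> D) w"
  shows "word_eval (Aut \<Delta> D) w \<noteq> \<one>\<^bsub>Aut \<Delta> D\<^esub>"
proof
  assume eq: "word_eval (Aut \<Delta> D) w = \<one>\<^bsub>Aut \<Delta> D\<^esub>"
  interpret A: group "Aut \<Delta> D" by (rule group_Aut)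
  have one: "\<one>\<^bsub>Aut \<Delta> D\<^esub> \<in> Af2 \<Delta> D" "\<one>\<^bsub>Aut \<Delta> D\<^esub> \<in> Tr2 \<Delta> D"
    using subgroup_Af2 subgroup_Tr2 by (auto dest: subgroup.one_closed)
  have big: "word_eval (Aut \<Delta> D) v \<notin> Af2 \<Delta> D"
    if "v \<in> lists (Af2 \<Delta> D <+> Tr2 \<Delta> D)" "v \<noteq> []" "alternating (Af2 \<Delta> D \<inter> Tr2 \<Delta> D) v" "\<not> isl (hd v)" for v
  proof
    assume "word_eval (Aut \<Delta> D) v \<in> Af2 \<Delta> D"
    moreover from this have "word_eval (Aut \<Delta> D) v \<in> carrier (Aut \<Delta> D)"
      by (simp add: Af2_iff carrier_Aut)
    moreover have "big (\<one>\<^bsub>Aut \<Delta> D\<^esub> \<otimes>\<^bsub>Aut \<Delta> D\<^esub> word_eval (Aut \<Delta> D) v)"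
      using that ydom_one A.one_closed by (intro alternating_big) (auto simp: carrier_Aut)
    ultimately show False using affine_not_big by simp
  qed
  obtain l v where lv: "w = l # v" using w(2) by (cases w) auto
  show False
  proof (cases l)
    case (Inr b)
    with big[OF w alt] eq one lv show False by simp
  next
    case (Inl a)
    have a: "a \<in> Af2 \<Delta> D" "a \<notin> Tr2 \<Delta> D"
      using w alt lv Inl by (auto simp: alternating_Cons)
    have aA: "a \<in> carrier (Aut \<Delta> D)" using a by (simp add: Af2_iff carrier_Aut)
    show False
    proof (cases "v = []")
      case True
      then have "a = \<one>\<^bsub>Aut \<Delta> D\<^esub>" using eq lv Inl aA by (simp add: word_eval_def)
      with a one show False by simp
    next
      case False
      have v: "v \<in> lists (Af2 \<Delta> D <+> Tr2 \<Delta> D)" "alternating (Af2 \<Delta> D \<inter> Tr2 \<Delta> D) v" "\<not> isl (hd v)"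
        using w alt lv Inl False by (auto simp: alternating_Cons)
      have ev: "word_eval (Aut \<Delta> D) v \<in> carrier (Aut \<Delta> D)" if "v \<in> lists (Af2 \<Delta> D <+> Tr2 \<Delta> D)" for v
        using A.word_eval_closed[OF that subgroup.subset[OF subgroup_Af2] subgroup.subset[OF subgroup_Tr2]]
    by (simp add: carrier_Aut)
      have "a \<otimes>\<^bsub>Aut \<Delta> D\<^esub> word_eval (Aut \<Delta> D) v = \<one>\<^bsub>Aut \<Delta> D\<^esub>"
        using eq lv Inl by (simp add: word_eval_def)
      then have "word_eval (Aut \<Delta> D) v = inv\<^bsub>Aut \<Delta> D\<^esub> a"
        using aA ev[OF v(1)] A.inv_equality A.inv_comm by metis
      then have "word_eval (Aut \<Delta> D) v \<in> Af2 \<Delta> D"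
        using a subgroup_Af2 by (simp add: subgroup.m_inv_closed)
      with big[OF v(1) False v(2,3)] show False by simp
    qed
  qed
qed

end

theorem mainTheorem1:
  fixes \<Delta> :: "'d set" and D :: "'d \<Rightarrow> 'k::field_char_0 \<Rightarrow> 'k"
  assumes "finite \<Delta>" and "differential_ring \<Delta> D"
  shows "is_amalgamated_free_product (Tame \<Delta> D) (Af2 \<Delta> D) (Tr2 \<Delta> D) (Af2 \<Delta> D \<inter> Tr2 \<Delta> D)"
proof -
  interpret diff_field \<Delta> D using assms by unfold_locales
  obtain rank q where "ranked \<Delta> D rank q" using ranking_exists by blast
  then interpret ranked \<Delta> D rank q .
  have "word_eval (Tame \<Delta> D) = word_eval (Aut \<Delta> D)" "\<one>\<^bsub>Tame \<Delta> D\<^esub> = \<one>\<^bsub>Aut \<Delta> D\<^esub>"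
    by (simp_all add: word_eval_def fun_eq_iff Tame_def)
  then show ?thesis
    using alternating_nontrivial
    by (intro amalgam_criterion group_Tame subgroups_Tame Tame_generated) simp
qed

end
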